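(* Let $\{\omega_{n,j}: n\in\mathbb{Z}_+,\ j=0,1,\dots,2^n-1\}$ be independent and identically distributed random variables on a probability space $(\Omega,\mathcal{F},\mathrm{P})$ with $\mathrm{P}(\omega_{n,j}=1)=\mathrm{P}(\omega_{n,j}=-1)=1/2$. Set $\omega_n(x):=\omega_{n,j}$ if $x\in[j/2^n,(j+1)/2^n)$, and let $f$ be the random function $$f(x)=\sum_{n=0}^\infty\frac{\omega_n(x)}{2^n}\phi(2^n x),\qquad 0\le x\le 1.$$ Then, almost surely, $$\dim_H L_f(0)=d_0:=\frac{\log\big((1+\sqrt5)/2\big)}{\log 4}.$$
   Context: $\mathbb{Z}_+$ is the set of nonnegative integers. $\phi(x)=\operatorname{dist}(x,\mathbb{Z})$ is the distance from $x\in\mathbb{R}$ to the nearest integer. The value $\omega_n(1)$ is immaterial since $\phi(2^n)=0$. $L_f(0)=\{x\in[0,1]: f(x)=0\}$. $\dim_H$ denotes Hausdorff dimension. *)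

theory Defs
  imports "HOL-Probability.Probability"
begin

text \<open>
  Hausdorff measure and dimension. The library's \<^const>\<open>diameter\<close> is unspecified on unbounded
  sets and \<open>0 powr 0 = 0\<close>, so covering sets are required to be bounded, and for \<open>s = 0\<close> the
  convention \<open>diam(U)^0 = 1\<close> for nonempty \<open>U\<close> is spelled out.
\<close>

definition diam_pow :: "real \<Rightarrow> 'a::metric_space set \<Rightarrow> real" where
  "diam_pow s U = (if U = {} then 0 else if s = 0 then 1 else diameter U powr s)"

definition hausdorff_premeasure :: "real \<Rightarrow> real \<Rightarrow> 'a::metric_space set \<Rightarrow> ennreal" where
  "hausdorff_premeasure s \<delta> A =
     (INF U \<in> {U :: nat \<Rightarrow> 'a set. A \<subseteq> (\<Union>i. U i) \<and> (\<forall>i. bounded (U i) \<and> diameter (U i) \<le> \<delta>)}.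
        \<Sum>i. ennreal (diam_pow s (U i)))"

definition hausdorff_measure :: "real \<Rightarrow> 'a::metric_space set \<Rightarrow> ennreal" where
  "hausdorff_measure s A = (SUP \<delta> \<in> {0<..}. hausdorff_premeasure s \<delta> A)"

definition hausdorff_dim :: "'a::metric_space set \<Rightarrow> ereal" where
  "hausdorff_dim A = (INF s \<in> {s. 0 \<le> s \<and> hausdorff_measure s A = 0}. ereal s)"

definition dist_int :: "real \<Rightarrow> real" where
  "dist_int x = infdist x \<int>"

text \<open>
  For \<open>x \<in> [0,1)\<close>, \<open>j = \<lfloor>2^n x\<rfloor>\<close> is the unique index with \<open>x \<in> [j/2^n, (j+1)/2^n)\<close>. At \<open>x = 1\<close> the
  value is \<open>e n (2^n)\<close>, which is immaterial since \<open>dist_int (2^n) = 0\<close>.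
\<close>

definition dyadic_step :: "(nat \<Rightarrow> nat \<Rightarrow> real) \<Rightarrow> nat \<Rightarrow> real \<Rightarrow> real" where
  "dyadic_step e n x = e n (nat \<lfloor>2 ^ n * x\<rfloor>)"

definition signed_takagi :: "(nat \<Rightarrow> nat \<Rightarrow> real) \<Rightarrow> real \<Rightarrow> real" where
  "signed_takagi e x = (\<Sum>n. dyadic_step e n x / 2 ^ n * dist_int (2 ^ n * x))"

definition level_set :: "(real \<Rightarrow> real) \<Rightarrow> real \<Rightarrow> real set" where
  "level_set f y = {x \<in> {0..1}. f x = y}"

end

theory Submission
  imports Defs
begin

text \<open>
  On a dyadic interval of length \<open>2 ^ -n\<close> the function \<open>f\<close>, magnified by \<open>2 ^ n\<close>, is the sum of
  a linear function with integer values \<open>A\<close> and \<open>B\<close> at the endpoints and of an independent copy of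
  \<open>f\<close>. Halving the interval turns \<open>(A, B)\<close> into \<open>(2 A, A + B + \<sigma>)\<close> and \<open>(A + B + \<sigma>, 2 B)\<close> with a
  random sign \<open>\<sigma>\<close>. Since \<open>f\<close> starts in state \<open>(0, 0)\<close> and has modulus below 1, zeros can only lie
  in intervals with \<open>A = 0\<close> or \<open>B = 0\<close>, and each such live interval does contain one, at an endpoint.
  The zero set is therefore the limit set of the tree of live intervals
  (\<open>level_set_eq_live_cells\<close>). This tree is a branching process whose types are the slopes
  \<open>k = \<bar>A + B\<bar>\<close>: slope 0 has two children of slope 1; slope \<open>k \<ge> 1\<close> has a child whose slope makes a
  step of simple random walk; and when the walk steps from 1 to 0 there is an extra child of slope 2
  (\<open>offspring_sum\<close>).

  Give each level a factor \<open>x\<close>. A walk started at 2 hits 1 with generating function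
  \<open>g = (1 - sqrt (1 - x\<^sup>2)) / x\<close>, so an interval of slope 1 has
  \<open>x\<^sup>2 + x * g = 1 + x\<^sup>2 - sqrt (1 - x\<^sup>2)\<close> weighted next descendants of slope 1 on average. This mean
  equals 1 if \<open>x ^ 4 + x\<^sup>2 = 1\<close>, and with \<open>x = 2 powr - s\<close> the solution is
  \<open>s = ln ((1 + sqrt 5) / 2) / ln 4\<close>.

  For larger \<open>s\<close> the expected number of live intervals of level \<open>n\<close> is bounded by a constant times
  \<open>x ^ -n\<close>, because the branching operator has a supersolution bounded away from 0
  (\<open>supersolution_exists\<close>). Hence the sums over the natural covers tend to 0 almost surely
  (\<open>population_decay\<close>).

  For smaller \<open>s\<close> the mass distribution principle is replaced by percolation. Keep each edge of the
  tree with probability \<open>r = 2 powr - s\<close>. The probability of reaching level \<open>n\<close> is at most the sum of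
  \<open>r ^ depth\<close> over any cut, so a positive limit bounds all covers of the zero set from below
  (\<open>premeasure_pos_if_percolates\<close>). A subsolution of the recursion shows that the limit is positive with
  positive probability (\<open>mean_percolation_lower\<close>). That it is positive almost surely is a zero-one
  law: the probability of a zero limit is, as a function of the slope \<open>k \<ge> 1\<close>, bounded and convex,
  hence nonincreasing, and the branching at slope 1 then leaves only the values 0 and 1
  (\<open>bounded_subharmonic_zero\<close>).
\<close>

section \<open>Live dyadic intervals\<close>

text \<open>
  A node of the binary tree is the list of left (\<open>False\<close>) and right (\<open>True\<close>) turns that lead to
  it from the root, so that every list is a node and passing to a subtree is prefixing a list. A
  coin at each node decides the sign of the tent placed on the corresponding dyadic interval.
\<close>

definition subtree :: "bool \<Rightarrow> (bool list \<Rightarrow> bool) \<Rightarrow> bool list \<Rightarrow> bool" where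
  "subtree b t = (\<lambda>l. t (b # l))"

definition spin :: "bool \<Rightarrow> int" where
  "spin c = (if c then 1 else -1)"

text \<open>
  The state of a dyadic interval of length \<open>2 ^ -n\<close> consists of the values of \<open>2 ^ n f\<close> at its
  two endpoints. The tent on the interval raises or lowers the midpoint value \<open>(A + B) / 2\<close> by
  \<open>1 / 2\<close>; after rescaling by 2 the midpoint contributes \<open>A + B + spin c\<close>.
\<close>

fun child :: "bool \<Rightarrow> bool \<Rightarrow> int \<times> int \<Rightarrow> int \<times> int" where
  "child b c (A, B) = (if b then (A + B + spin c, 2 * B) else (2 * A, A + B + spin c))"

text \<open>
  A live interval carries a zero of \<open>f\<close> at an endpoint. A dead child of a live interval has
  endpoint values of one sign and of modulus at least 1, which is too large for the rest of the
  series to cancel (\<open>zero_imp_alive_child\<close> below).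
\<close>

fun alive :: "int \<times> int \<Rightarrow> bool" where
  "alive (A, B) \<longleftrightarrow> A = 0 \<or> B = 0"

primrec live :: "bool list \<Rightarrow> (bool list \<Rightarrow> bool) \<Rightarrow> int \<times> int \<Rightarrow> bool" where
  "live [] t s \<longleftrightarrow> alive s"
| "live (b # l) t s \<longleftrightarrow> alive s \<and> live l (subtree b t) (child b (t []) s)"

text \<open>
  The signs that \<open>f\<close> uses on the left or right half of the unit interval, seen from that half.
\<close>

definition half :: "bool \<Rightarrow> (nat \<Rightarrow> nat \<Rightarrow> real) \<Rightarrow> nat \<Rightarrow> nat \<Rightarrow> real" where
  "half b e n j = e (Suc n) (of_bool b * 2 ^ n + j)"

primrec address :: "bool list \<Rightarrow> nat" where
  "address [] = 0"
| "address (b # l) = of_bool b * 2 ^ length l + address l"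

definition coins :: "(nat \<Rightarrow> nat \<Rightarrow> real) \<Rightarrow> bool list \<Rightarrow> bool" where
  "coins e l \<longleftrightarrow> e (length l) (address l) = 1"

text \<open>
  Only the indices \<open>j < 2 ^ n\<close> belong to points of \<open>[0,1)\<close>; the others are unconstrained.
\<close>

definition signs :: "(nat \<Rightarrow> nat \<Rightarrow> real) \<Rightarrow> bool" where
  "signs e \<longleftrightarrow> (\<forall>n. \<forall>j<2 ^ n. e n j = 1 \<or> e n j = -1)"

text \<open>
  The function on a dyadic interval, rescaled to unit length: the chord between the two endpoint
  values plus a signed Takagi function built from the signs below that interval.
\<close>

fun height :: "(nat \<Rightarrow> nat \<Rightarrow> real) \<Rightarrow> int \<times> int \<Rightarrow> real \<Rightarrow> real" where
  "height e (A, B) x = A + (B - A) * x + signed_takagi e x"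

declare height.simps [simp del]

definition cell :: "bool list \<Rightarrow> real set" where
  "cell l = {address l / 2 ^ length l .. (address l + 1) / 2 ^ length l}"

section \<open>Self-similarity of the signed Takagi function\<close>

lemma coins_half: "coins (half b e) = subtree b (coins e)"
  by (auto simp: coins_def half_def subtree_def fun_eq_iff)

lemma signs_half: assumes "signs e" shows "signs (half b e)"
  unfolding signs_def half_def
proof (intro allI impI)
  fix n j :: nat assume "j < 2 ^ n"
  then have "of_bool b * 2 ^ n + j < 2 ^ Suc n" by (cases b) auto
  then show "e (Suc n) (of_bool b * 2 ^ n + j) = 1 \<or> e (Suc n) (of_bool b * 2 ^ n + j) = - 1"
    using assms unfolding signs_def by blast
qed

lemma signs_root: "signs e \<Longrightarrow> e 0 0 = spin (coins e [])"
  unfolding signs_def coins_def spin_def by (auto dest!: spec[of _ 0])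

lemma address_less: "address l < 2 ^ length l"
  by (induction l) auto

lemma address_inj: "length l = length l' \<Longrightarrow> address l = address l' \<Longrightarrow> l = l'"
proof (induction l l' rule: list_induct2')
  case (4 b l b' l')
  then have "length l = length l'" by simp
  moreover have "address l < 2 ^ length l" "address l' < 2 ^ length l'" by (rule address_less)+
  ultimately show ?case using 4 by (cases b; cases b') auto
qed auto

lemma dist_int_le: "\<bar>x - of_int k\<bar> \<le> y \<Longrightarrow> dist_int x \<le> y"
  unfolding dist_int_def by (rule order_trans[OF infdist_le[of "of_int k"]]) (auto simp: dist_real_def)

lemma dist_int_nonneg: "0 \<le> dist_int x"
  unfolding dist_int_def by (rule infdist_nonneg)

lemma dist_int_Ints: "x \<in> \<int> \<Longrightarrow> dist_int x = 0"
  unfolding dist_int_def by simp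

lemma Ints_nonempty: "(\<int> :: real set) \<noteq> {}"
  using Ints_0 by blast

lemma dist_int_eqI:
  assumes "\<bar>x - of_int k\<bar> \<le> 1 / 2" shows "dist_int x = \<bar>x - of_int k\<bar>"
proof (rule antisym)
  show "dist_int x \<le> \<bar>x - of_int k\<bar>" by (rule dist_int_le) (rule order_refl)
  show "\<bar>x - of_int k\<bar> \<le> dist_int x"
    unfolding dist_int_def infdist_notempty[OF Ints_nonempty]
  proof (rule cINF_greatest[OF Ints_nonempty])
    fix a :: real assume "a \<in> \<int>"
    then obtain m :: int where m: "a = of_int m" by (auto elim: Ints_cases)
    show "\<bar>x - of_int k\<bar> \<le> dist x a"
    proof (cases "m = k")
      case False
      then have "1 \<le> \<bar>m - k\<bar>" by simp
      then have "1 \<le> \<bar>real_of_int m - of_int k\<bar>"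
        by (metis of_int_1_le_iff of_int_abs of_int_diff)
      then show ?thesis using assms unfolding dist_real_def m by linarith
    qed (simp add: m dist_real_def)
  qed
qed

lemma dist_int_le_half: "dist_int x \<le> 1 / 2"
  by (rule dist_int_le[of _ "round x"]) (use of_int_round_abs_le[of x] in \<open>simp add: abs_minus_commute\<close>)

lemma dist_int_add_int: "dist_int (x + of_int k) = dist_int x"
proof -
  have "\<bar>x - round x\<bar> \<le> 1 / 2"
    using of_int_round_abs_le[of x] by (simp add: abs_minus_commute)
  then show ?thesis
    using dist_int_eqI[of x "round x"] dist_int_eqI[of "x + of_int k" "round x + k"] by simp
qed

lemma takagi_term_le:
  assumes "signs e" "0 \<le> x" "x \<le> 1"
  shows "\<bar>dyadic_step e n x / 2 ^ n * dist_int (2 ^ n * x)\<bar> \<le> (1 / 2) ^ Suc n"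
proof (cases "x = 1")
  case True
  have "(2::real) ^ n \<in> \<int>" by simp
  then show ?thesis using True by (simp add: dist_int_Ints)
next
  case False
  then have "2 ^ n * x < 2 ^ n" using assms by simp
  then have "nat \<lfloor>2 ^ n * x\<rfloor> < 2 ^ n"
    using assms by (simp add: nat_less_iff floor_less_iff)
  then have "\<bar>dyadic_step e n x\<bar> = 1"
    using assms(1) unfolding signs_def dyadic_step_def by fastforce
  then show ?thesis
    using dist_int_le_half[of "2 ^ n * x"] dist_int_nonneg[of "2 ^ n * x"]
    by (simp add: abs_mult power_divide field_simps)
qed

lemma takagi_summable:
  assumes "signs e" "0 \<le> x" "x \<le> 1"
  shows "summable (\<lambda>n. dyadic_step e n x / 2 ^ n * dist_int (2 ^ n * x))"
proof (rule summable_comparison_test'[where N = 0])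
  show "summable (\<lambda>n. (1 / 2 :: real) ^ Suc n)" by (simp add: summable_mult)
  show "norm (dyadic_step e n x / 2 ^ n * dist_int (2 ^ n * x)) \<le> (1 / 2) ^ Suc n" for n
    using takagi_term_le[OF assms] by simp
qed

lemma takagi_le_one:
  assumes "signs e" "0 \<le> x" "x \<le> 1"
  shows "\<bar>signed_takagi e x\<bar> \<le> 1"
proof -
  have s: "(\<lambda>n. (1 / 2 :: real) ^ Suc n) sums 1"
    using geometric_sums[of "1/2::real"] sums_mult[of "\<lambda>n. (1/2::real)^n" 2 "1/2"] by simp
  have "norm (signed_takagi e x) \<le> (\<Sum>n. (1 / 2) ^ Suc n)"
    unfolding signed_takagi_def
    by (rule norm_suminf_le[OF _ sums_summable[OF s]]) (use takagi_term_le[OF assms] in simp)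
  then show ?thesis using s by (simp add: sums_iff)
qed

lemma takagi_endpoints: "signed_takagi e 0 = 0" "signed_takagi e 1 = 0"
  unfolding signed_takagi_def by (simp_all add: dist_int_Ints)

text \<open>
  The first term of the series is a tent of height \<open>1 / 2\<close>, and the later ones are the series
  of the half that contains the point, scaled by \<open>1 / 2\<close>.
\<close>

lemma takagi_half:
  assumes e: "signs e" and y: "0 \<le> y" "y \<le> 1"
  shows "signed_takagi e ((of_bool b + y) / 2)
         = (e 0 0 * (if b then 1 - y else y) + signed_takagi (half b e) y) / 2"
proof -
  let ?x = "(of_bool b + y) / 2"
  let ?u = "\<lambda>e x n. dyadic_step e n x / 2 ^ n * dist_int (2 ^ n * x)"
  have x: "0 \<le> ?x" "?x \<le> 1" using y by (cases b; simp)+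
  have 0: "?u e ?x 0 = e 0 0 * (if b then 1 - y else y) / 2"
  \<comment> \<open>At the right end the sign index is out of range, and the distance to the integers is 0.\<close>
  proof (cases "?x = 1")
    case True
    then have "b" "y = 1" using y by (cases b; simp)+
    then show ?thesis by (simp add: dist_int_Ints)
  next
    case False
    then have "\<lfloor>?x\<rfloor> = 0" using x by (simp add: floor_eq_iff)
    moreover have "dist_int ?x = (if b then 1 - y else y) / 2"
      using dist_int_eqI[of ?x "of_bool b"] y by (cases b) (auto simp: abs_if field_simps)
    ultimately show ?thesis by (simp add: dyadic_step_def)
  qed
  have S: "?u e ?x (Suc n) = ?u (half b e) y n / 2" for n
  proof -
    have eq: "2 ^ Suc n * ?x = 2 ^ n * y + of_int (of_bool b * 2 ^ n)"
      by (cases b) (auto simp: field_simps)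
    have d: "dist_int (2 ^ Suc n * ?x) = dist_int (2 ^ n * y)"
      unfolding eq by (rule dist_int_add_int)
    have "nat \<lfloor>2 ^ Suc n * ?x\<rfloor> = of_bool b * 2 ^ n + nat \<lfloor>2 ^ n * y\<rfloor>"
      unfolding eq floor_add_int[symmetric] using y by (cases b) (auto simp: nat_add_distrib nat_power_eq)
    then have "dyadic_step e (Suc n) ?x = dyadic_step (half b e) n y"
      unfolding dyadic_step_def half_def by simp
    then show ?thesis unfolding d by simp
  qed
  have "signed_takagi e ?x = (\<Sum>n. ?u e ?x (Suc n)) + ?u e ?x 0"
    unfolding signed_takagi_def using suminf_split_head[OF takagi_summable[OF e x]] by linarith
  also have "(\<Sum>n. ?u e ?x (Suc n)) = signed_takagi (half b e) y / 2"
    unfolding S signed_takagi_def by (rule suminf_divide[OF takagi_summable[OF signs_half[OF e] y]])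
  finally show ?thesis unfolding 0 by simp
qed

lemma halves:
  fixes x :: real assumes "0 \<le> x" "x \<le> 1"
  obtains b y where "0 \<le> y" "y \<le> 1" "x = (of_bool b + y) / 2"
proof (cases "x \<le> 1 / 2")
  case True
  then show ?thesis using that[of "2 * x" False] assms by simp
next
  case False
  then show ?thesis using that[of "2 * x - 1" True] assms by simp
qed

text \<open>
  The trivial bound is 1; it is never attained, because the first tent attains its maximum only
  at \<open>1 / 2\<close>, where all later terms vanish.
\<close>

lemma takagi_less_one:
  assumes e: "signs e" and x: "0 \<le> x" "x \<le> 1"
  shows "\<bar>signed_takagi e x\<bar> < 1"
proof -
  obtain b y where y: "0 \<le> y" "y \<le> 1" and xy: "x = (of_bool b + y) / 2"
    using halves[OF x] .
  define u where "u = (if b then 1 - y else y)"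
  have e0: "\<bar>e 0 0\<bar> = 1" using signs_root[OF e] by (simp add: spin_def)
  have T: "\<bar>signed_takagi (half b e) y\<bar> \<le> 1" by (rule takagi_le_one[OF signs_half[OF e] y])
  have "\<bar>signed_takagi e x\<bar> \<le> (\<bar>e 0 0 * u\<bar> + \<bar>signed_takagi (half b e) y\<bar>) / 2"
    unfolding xy takagi_half[OF e y] u_def[symmetric] by (simp add: abs_triangle_ineq)
  also have "\<dots> = (u + \<bar>signed_takagi (half b e) y\<bar>) / 2"
    using e0 y unfolding u_def by (auto simp: abs_mult)
  also have "\<dots> < 1"
  proof (cases "u = 1")
    case True
    then have "y = 0 \<or> y = 1" unfolding u_def by (auto split: if_splits)
    then show ?thesis using True by (auto simp: takagi_endpoints)
  next
    case False
    then have "u < 1" unfolding u_def using y by (auto split: if_splits)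
    then show ?thesis using T by simp
  qed
  finally show ?thesis .
qed

lemma height_half:
  assumes e: "signs e" and y: "0 \<le> y" "y \<le> 1"
  shows "height e s ((of_bool b + y) / 2) = height (half b e) (child b (coins e []) s) y / 2"
proof -
  obtain A B where s: "s = (A, B)" by (cases s)
  show ?thesis unfolding s
    by (cases b) (simp_all only: child.simps if_True if_False height.simps takagi_half[OF e y]
      signs_root[OF e], simp_all add: field_simps)
qed

section \<open>The zero set as the limit set of the live intervals\<close>

lemma cell_Nil: "cell [] = {0..1}"
  by (simp add: cell_def)

lemma mem_cell_Cons: "(of_bool b + y) / 2 \<in> cell (b # l) \<longleftrightarrow> y \<in> cell l"
proof -
  define p where "p = (2::real) ^ length l"
  have "p > 0" unfolding p_def by simp
  then show ?thesis
    by (cases b) (auto simp: cell_def field_simps p_def[symmetric])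
qed

lemma cell_subset: "cell l \<subseteq> {0..1}"
proof -
  have "real (address l + 1) \<le> real (2 ^ length l)"
    using address_less[of l] by (intro of_nat_mono) simp
  then have "(real (address l) + 1) / 2 ^ length l \<le> 1" by (simp add: add.commute)
  then show ?thesis unfolding cell_def by auto
qed

lemma live_alive: "live l t s \<Longrightarrow> alive s"
  by (cases l) auto

text \<open>
  The endpoint values of a dead child of a live interval are \<open>2 k\<close> and \<open>k + 1\<close> or \<open>k - 1\<close>, in
  some order, with a nonzero integer \<open>k\<close>. As they are nonzero, they have the same sign. The chord
  then has modulus at least 1, and the Takagi part is strictly smaller.
\<close>

lemma zero_imp_alive_child:
  assumes e: "signs e" and y: "0 \<le> y" "y \<le> 1" and s: "alive s"
    and z: "height e (child b c s) y = 0"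
  shows "alive (child b c s)"
proof (rule ccontr)
  assume dead: "\<not> alive (child b c s)"
  obtain A B where AB: "child b c s = (A, B)" by (cases "child b c s")
  have "(A \<ge> 1 \<and> B \<ge> 1) \<or> (A \<le> -1 \<and> B \<le> -1)"
    using dead s AB by (cases s; cases b; cases c) (auto simp: spin_def)
  then have "1 \<le> \<bar>A + (B - A) * y\<bar>"
  proof
    assume "1 \<le> A \<and> 1 \<le> B"
    then have "1 * (1 - y) + 1 * y \<le> A * (1 - y) + B * y"
      using y by (intro add_mono mult_right_mono) auto
    then show ?thesis by (simp add: algebra_simps)
  next
    assume "A \<le> -1 \<and> B \<le> -1"
    then have "A * (1 - y) + B * y \<le> (-1) * (1 - y) + (-1) * y"
      using y by (intro add_mono mult_right_mono) auto
    then show ?thesis by (simp add: algebra_simps)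
  qed
  then show False using z takagi_less_one[OF e y] unfolding AB height.simps by simp
qed

lemma zero_in_live_cell:
  assumes "signs e" "alive s" "x \<in> {0..1}" "height e s x = 0"
  shows "\<exists>l. length l = n \<and> live l (coins e) s \<and> x \<in> cell l"
  using assms
proof (induction n arbitrary: e s x)
  case 0
  then show ?case by (intro exI[of _ "[]"]) (simp add: cell_Nil)
next
  case (Suc n)
  obtain b y where y: "0 \<le> y" "y \<le> 1" and xy: "x = (of_bool b + y) / 2"
    by (rule halves[of x]) (use Suc.prems(3) in auto)
  note e' = signs_half[OF Suc.prems(1), of b]
  have z: "height (half b e) (child b (coins e []) s) y = 0"
    using Suc.prems(4) unfolding xy height_half[OF Suc.prems(1) y] by simp
  obtain l where "length l = n" "live l (coins (half b e)) (child b (coins e []) s)" "y \<in> cell l"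
    using Suc.IH[OF e' zero_imp_alive_child[OF e' y Suc.prems(2) z] _ z] y by auto
  then show ?case
    using Suc.prems(2) by (intro exI[of _ "b # l"]) (simp add: coins_half xy mem_cell_Cons)
qed

lemma live_cell_has_zero:
  assumes "signs e" "live l (coins e) s"
  shows "\<exists>z\<in>cell l. height e s z = 0"
  using assms
proof (induction l arbitrary: e s)
  case Nil
  then show ?case
    by (cases s) (auto simp: height.simps cell_Nil takagi_endpoints intro: bexI[of _ 0] bexI[of _ 1])
next
  case (Cons b l)
  obtain z where z: "z \<in> cell l" "height (half b e) (child b (coins e []) s) z = 0"
    using Cons.IH[OF signs_half[OF Cons.prems(1), of b], of "child b (coins e []) s"] Cons.prems(2)
    unfolding coins_half by auto
  then have "0 \<le> z" "z \<le> 1" using cell_subset[of l] by auto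
  with z show ?case
    by (intro bexI[of _ "(of_bool b + z) / 2"])
       (auto simp: height_half[OF Cons.prems(1)] mem_cell_Cons)
qed

text \<open>
  For a live state this is the modulus of the slope of the chord, since one endpoint value is 0.
  It is the type of the interval in the branching process.
\<close>

definition slope :: "int \<times> int \<Rightarrow> nat" where
  "slope s = nat \<bar>fst s + snd s\<bar>"

lemma slope_child_le: "alive s \<Longrightarrow> alive (child b c s) \<Longrightarrow> slope (child b c s) \<le> slope s + 1"
  by (cases s; cases b; cases c) (auto simp: slope_def spin_def)

text \<open>
  Along a branch of live intervals the slope grows by at most 1 per level, while the scale is
  halved; so \<open>f\<close> is \<open>O(n 2 ^ -n)\<close> on the live intervals of level \<open>n\<close>.
\<close>

lemma height_on_live_cell:
  assumes "signs e" "live l (coins e) s" "x \<in> cell l"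
  shows "\<bar>height e s x\<bar> \<le> (1 + slope s + length l) / 2 ^ length l"
  using assms
proof (induction l arbitrary: e s x)
  case Nil
  obtain A B where s: "s = (A, B)" by (cases s)
  have x: "0 \<le> x" "x \<le> 1" using Nil by (auto simp: cell_Nil)
  have "\<bar>A + (B - A) * x\<bar> \<le> slope s"
  proof (cases "A = 0")
    case True
    then show ?thesis using x by (simp add: s slope_def abs_mult mult_left_le)
  next
    case False
    then have "B = 0" using Nil s by simp
    then have "A + (B - A) * x = A * (1 - x)" by (simp add: algebra_simps)
    then show ?thesis using x \<open>B = 0\<close> by (simp add: s slope_def abs_mult mult_left_le)
  qed
  then show ?case using takagi_le_one[OF Nil(1) x] by (simp add: s height.simps)
next
  case (Cons b l)
  define y where "y = 2 * x - of_bool b"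
  have xy: "x = (of_bool b + y) / 2" unfolding y_def by simp
  have y: "y \<in> cell l" using Cons.prems(3) unfolding xy mem_cell_Cons .
  then have y01: "0 \<le> y" "y \<le> 1" using cell_subset[of l] by auto
  let ?s = "child b (coins e []) s"
  have l: "live l (coins (half b e)) ?s" using Cons.prems(2) by (simp add: coins_half)
  have "slope ?s \<le> slope s + 1"
    using slope_child_le live_alive[OF l] Cons.prems(2) by simp
  have "\<bar>height e s x\<bar> = \<bar>height (half b e) ?s y\<bar> / 2"
    unfolding xy height_half[OF Cons.prems(1) y01] by simp
  also have "\<dots> \<le> (1 + slope ?s + length l) / 2 ^ length l / 2"
    by (intro divide_right_mono Cons.IH[OF signs_half[OF Cons.prems(1)] l y]) simp
  also have "\<dots> = (1 + slope ?s + length l) / 2 ^ length (b # l)" by simp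
  also have "\<dots> \<le> (1 + slope s + length (b # l)) / 2 ^ length (b # l)"
    using \<open>slope ?s \<le> slope s + 1\<close> by (intro divide_right_mono of_nat_mono) simp_all
  finally show ?case .
qed

definition live_set :: "nat \<Rightarrow> (bool list \<Rightarrow> bool) \<Rightarrow> int \<times> int \<Rightarrow> bool list set" where
  "live_set n t s = {l. length l = n \<and> live l t s}"

lemma finite_live_set: "finite (live_set n t s)"
  unfolding live_set_def using finite_lists_length_eq[of "UNIV :: bool set" n] by (rule rev_finite_subset) auto

text \<open>
  Zeros never leave the live intervals, and \<open>f\<close> is uniformly small on the live intervals of high
  level. The equality also shows that the zero set is compact.
\<close>

lemma level_set_eq_live_cells:
  assumes "signs e"
  shows "level_set (signed_takagi e) 0 = (\<Inter>n. \<Union>l\<in>live_set n (coins e) (0, 0). cell l)"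
    (is "?L = ?R")
proof
  show "?L \<subseteq> ?R"
    using zero_in_live_cell[OF assms, of "(0, 0)"] by (force simp: level_set_def live_set_def height.simps)
  show "?R \<subseteq> ?L"
  proof
    fix x assume x: "x \<in> ?R"
    have "\<bar>signed_takagi e x\<bar> \<le> (1 + real n) / 2 ^ n" for n
    proof -
      obtain l where "live l (coins e) (0, 0)" "length l = n" "x \<in> cell l"
        using x by (auto simp: live_set_def)
      then show ?thesis using height_on_live_cell[OF assms, of l "(0, 0)" x] by (simp add: slope_def height.simps)
    qed
    moreover have "(\<lambda>n. (1 + real n) / 2 ^ n) \<longlonglongrightarrow> 0" by real_asymp
    ultimately have "\<bar>signed_takagi e x\<bar> \<le> 0" by (intro LIMSEQ_le_const) auto
    moreover have "x \<in> {0..1}" using x cell_subset by blast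
    ultimately show "x \<in> ?L" by (simp add: level_set_def)
  qed
qed

lemma compact_level_set:
  assumes "signs e" shows "compact (level_set (signed_takagi e) 0)"
proof -
  have "compact (\<Union>l\<in>live_set n (coins e) (0, 0). cell l)" for n
    by (intro compact_UN finite_live_set) (simp add: cell_def)
  then show ?thesis unfolding level_set_eq_live_cells[OF assms] by (intro compact_Inter) auto
qed

section \<open>The law of a tree of fair coins\<close>

definition fair_tree :: "(bool list \<Rightarrow> bool) measure" where
  "fair_tree = (\<Pi>\<^sub>M l\<in>UNIV. measure_pmf (bernoulli_pmf (1 / 2)))"

interpretation fair_tree: prob_space fair_tree
  unfolding fair_tree_def by (intro prob_space_PiM measure_pmf.prob_space_axioms)

lemma sets_fair_tree: "sets fair_tree = sets (\<Pi>\<^sub>M l\<in>UNIV. count_space (UNIV :: bool set))"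
  unfolding fair_tree_def by (intro sets_PiM_cong) auto

lemma space_fair_tree: "space fair_tree = UNIV"
  unfolding fair_tree_def by (simp add: space_PiM)

lemma measurable_coin: "(\<lambda>t. t l) \<in> fair_tree \<rightarrow>\<^sub>M count_space UNIV"
  unfolding measurable_cong_sets[OF sets_fair_tree refl] by measurable

lemma measurable_fair_treeI:
  assumes "\<And>l. (\<lambda>x. f x l) \<in> N \<rightarrow>\<^sub>M count_space (UNIV :: bool set)"
  shows "f \<in> N \<rightarrow>\<^sub>M fair_tree"
  unfolding measurable_cong_sets[OF refl sets_fair_tree]
  by (rule measurable_PiM_single') (use assms in auto)

lemma measurable_subtree: "subtree b \<in> fair_tree \<rightarrow>\<^sub>M fair_tree"
  by (rule measurable_fair_treeI) (simp add: subtree_def measurable_coin)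

lemma measurable_root_subtree:
  assumes "\<And>c. F c \<in> fair_tree \<rightarrow>\<^sub>M N"
  shows "(\<lambda>t. F (t []) (subtree b t)) \<in> fair_tree \<rightarrow>\<^sub>M N"
  by (rule measurable_compose_countable[OF _ measurable_coin])
     (rule measurable_compose[OF measurable_subtree assms])

definition graft :: "bool \<times> (bool list \<Rightarrow> bool) \<times> (bool list \<Rightarrow> bool) \<Rightarrow> bool list \<Rightarrow> bool" where
  "graft = (\<lambda>(c, l, r) p. case p of [] \<Rightarrow> c | b # q \<Rightarrow> (if b then r else l) q)"

lemma graft_simps:
  "graft (c, l, r) [] = c" "graft (c, l, r) (b # q) = (if b then r else l) q"
  "subtree False (graft (c, l, r)) = l" "subtree True (graft (c, l, r)) = r"
  by (simp_all add: graft_def subtree_def)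

abbreviation "graft_law \<equiv> measure_pmf (bernoulli_pmf (1 / 2)) \<Otimes>\<^sub>M (fair_tree \<Otimes>\<^sub>M fair_tree)"

lemma measurable_graft: "graft \<in> graft_law \<rightarrow>\<^sub>M fair_tree"
proof (rule measurable_fair_treeI)
  fix p :: "bool list"
  have 1: "(\<lambda>x. fst x) \<in> graft_law \<rightarrow>\<^sub>M count_space UNIV"
    using measurable_fst[of "measure_pmf (bernoulli_pmf (1 / 2))" "fair_tree \<Otimes>\<^sub>M fair_tree"]
    by simp
  have 2: "(\<lambda>x. fst (snd x) q) \<in> graft_law \<rightarrow>\<^sub>M count_space UNIV" for q
    by (intro measurable_compose[OF _ measurable_coin]) measurable
  have 3: "(\<lambda>x. snd (snd x) q) \<in> graft_law \<rightarrow>\<^sub>M count_space UNIV" for q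
    by (intro measurable_compose[OF _ measurable_coin]) measurable
  show "(\<lambda>x. graft x p) \<in> graft_law \<rightarrow>\<^sub>M count_space UNIV"
  proof (cases p)
    case Nil
    then show ?thesis using 1 by (simp add: graft_def case_prod_beta)
  next
    case (Cons b q)
    then show ?thesis using 2[of q] 3[of q] by (cases b) (simp_all add: graft_def case_prod_beta)
  qed
qed

lemma prod_bool_lists:
  fixes g :: "bool list \<Rightarrow> 'b::comm_monoid_mult"
  assumes "finite J"
  shows "prod g J = (if [] \<in> J then g [] else 1) * (prod (\<lambda>l. g (False # l)) {l. False # l \<in> J} *
    prod (\<lambda>l. g (True # l)) {l. True # l \<in> J})"
proof -
  have J: "J = (J \<inter> {[]}) \<union> ((#) False ` {l. False # l \<in> J} \<union> (#) True ` {l. True # l \<in> J})" (is "_ = ?N \<union> (?F \<union> ?T)")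
  proof (intro equalityI subsetI)
    fix l assume "l \<in> J"
    then show "l \<in> ?N \<union> (?F \<union> ?T)"
      by (cases l; cases "hd l") auto
  qed auto
  have fin: "finite {l. b # l \<in> J}" for b
    using finite_vimageI[OF assms, of "(#) b"] by (simp add: vimage_def)
  have "prod g J = prod g ?N * (prod g ?F * prod g ?T)"
    by (subst J, subst prod.union_disjoint, use assms fin in auto, subst prod.union_disjoint, use fin in auto)
  also have "prod g ?N = (if [] \<in> J then g [] else 1)" by simp
  also have "prod g ?F = prod (\<lambda>l. g (False # l)) {l. False # l \<in> J}"
    by (subst prod.reindex) auto
  also have "prod g ?T = prod (\<lambda>l. g (True # l)) {l. True # l \<in> J}"
    by (subst prod.reindex) auto
  finally show ?thesis .
qed

text \<open>
  Branching property: the root coin and the two subtrees are independent, and the subtrees have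
  the law of the whole tree. It suffices to compare the measures of finite-dimensional boxes, whose
  coordinates split into the root, the left and the right ones.
\<close>

lemma distr_graft: "distr graft_law fair_tree graft = fair_tree"
proof -
  let ?C = "measure_pmf (bernoulli_pmf (1 / 2))"
  interpret P: pair_prob_space fair_tree fair_tree ..
  interpret Q: pair_prob_space ?C "fair_tree \<Otimes>\<^sub>M fair_tree" ..
  have box: "emeasure fair_tree {t. \<forall>l\<in>J. t l \<in> X l} = (\<Prod>l\<in>J. emeasure ?C (X l))"
    and box_sets: "{t. \<forall>l\<in>J. t l \<in> X l} \<in> sets fair_tree"
    if "finite J" for J :: "bool list set" and X
  proof -
    interpret product_prob_space "\<lambda>_. ?C" "UNIV :: bool list set" ..
    show "emeasure fair_tree {t. \<forall>l\<in>J. t l \<in> X l} = (\<Prod>l\<in>J. emeasure ?C (X l))"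
      using emeasure_PiM_Collect[of J X] that by (simp add: fair_tree_def space_PiM)
    have "{t \<in> space fair_tree. \<forall>l\<in>J. t l \<in> X l} \<in> sets fair_tree"
      by (intro sets.sets_Collect_finite_All[OF _ that])
         (use measurable_coin in \<open>auto simp: measurable_def vimage_def space_fair_tree\<close>)
    then show "{t. \<forall>l\<in>J. t l \<in> X l} \<in> sets fair_tree" by (simp add: space_fair_tree)
  qed
  have "fair_tree = distr graft_law fair_tree graft"
  proof (rule measure_eqI_PiM_infinite[where I = UNIV and M = "\<lambda>_. ?C"])
    show "sets fair_tree = sets (\<Pi>\<^sub>M l\<in>UNIV. ?C)" by (simp add: fair_tree_def)
    show "sets (distr graft_law fair_tree graft) = sets (\<Pi>\<^sub>M l\<in>UNIV. ?C)" by (simp add: fair_tree_def)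
    show "finite_measure fair_tree" by unfold_locales
    fix X :: "bool list \<Rightarrow> bool set" and J :: "bool list set"
    assume J: "finite J"
    have fin: "finite {l. b # l \<in> J}" for b
      using finite_vimageI[OF J, of "(#) b"] by (simp add: vimage_def)
    have emb: "prod_emb UNIV (\<lambda>_. ?C) J (Pi\<^sub>E J X) = {t. \<forall>l\<in>J. t l \<in> X l}"
      by (auto simp: prod_emb_def)
    define B where "B b = {t. \<forall>l\<in>{l. b # l \<in> J}. t l \<in> X (b # l)}" for b :: bool
    have B_sets: "B b \<in> sets fair_tree" for b unfolding B_def by (rule box_sets[OF fin])
    have B_box: "emeasure fair_tree (B b) = (\<Prod>l\<in>{l. b # l \<in> J}. emeasure ?C (X (b # l)))" for b
      unfolding B_def by (rule box[OF fin])
    define R where "R = (if [] \<in> J then X [] else UNIV)"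
    have "graft -` {t. \<forall>l\<in>J. t l \<in> X l} \<inter> space graft_law = R \<times> (B False \<times> B True)"
    proof (intro equalityI subsetI)
      fix x assume "x \<in> graft -` {t. \<forall>l\<in>J. t l \<in> X l} \<inter> space graft_law"
      then have "\<forall>l\<in>J. graft x l \<in> X l" by simp
      then show "x \<in> R \<times> (B False \<times> B True)"
        by (cases x) (force simp: R_def B_def graft_simps dest: bspec)
    next
      fix x assume "x \<in> R \<times> (B False \<times> B True)"
      then obtain c t0 t1 where x: "x = (c, t0, t1)" "c \<in> R" "t0 \<in> B False" "t1 \<in> B True" by auto
      have "graft x l \<in> X l" if "l \<in> J" for l
      proof (cases l)
        case Nil
        then show ?thesis using x that by (simp add: R_def graft_simps)
      next
        case (Cons b q)
        then show ?thesis using x that by (cases b) (auto simp: B_def graft_simps)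
      qed
      then show "x \<in> graft -` {t. \<forall>l\<in>J. t l \<in> X l} \<inter> space graft_law"
        by (simp add: space_pair_measure space_fair_tree)
    qed
    then have "emeasure (distr graft_law fair_tree graft) {t. \<forall>l\<in>J. t l \<in> X l}
        = emeasure graft_law (R \<times> (B False \<times> B True))"
      by (simp add: emeasure_distr[OF measurable_graft box_sets[OF J]])
    also have "\<dots> = emeasure ?C R * (emeasure fair_tree (B False) * emeasure fair_tree (B True))"
      using B_sets P.sigma_finite_measure_axioms
      by (simp add: sigma_finite_measure.emeasure_pair_measure_Times fair_tree.emeasure_pair_measure_Times)
    also have "emeasure ?C R = (if [] \<in> J then emeasure ?C (X []) else 1)"
      by (simp add: R_def)
    finally show "emeasure fair_tree (prod_emb UNIV (\<lambda>_. ?C) J (Pi\<^sub>E J X))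
        = emeasure (distr graft_law fair_tree graft) (prod_emb UNIV (\<lambda>_. ?C) J (Pi\<^sub>E J X))"
      unfolding emb box[OF J] by (simp add: prod_bool_lists[OF J] B_box)
  qed
  then show ?thesis by (rule sym)
qed

lemma bounded_integrable:
  fixes F :: "(bool list \<Rightarrow> bool) \<Rightarrow> real"
  assumes "F \<in> borel_measurable fair_tree" "\<And>t. \<bar>F t\<bar> \<le> C"
  shows "integrable fair_tree F"
  by (rule fair_tree.integrable_const_bound[of _ C]) (use assms in auto)

text \<open>
  The form in which the branching property is used: every recursion for an expectation below is
  an instance of this formula.
\<close>

lemma integral_split_root:
  fixes F G :: "bool \<Rightarrow> (bool list \<Rightarrow> bool) \<Rightarrow> real"
  assumes F: "\<And>c. F c \<in> borel_measurable fair_tree" "\<And>c t. \<bar>F c t\<bar> \<le> C"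
    and G: "\<And>c. G c \<in> borel_measurable fair_tree" "\<And>c t. \<bar>G c t\<bar> \<le> D"
  shows "(\<integral>t. F (t []) (subtree False t) * G (t []) (subtree True t) \<partial>fair_tree)
    = (\<Sum>c\<in>UNIV. (\<integral>t. F c t \<partial>fair_tree) * (\<integral>t. G c t \<partial>fair_tree)) / 2"
proof -
  let ?C = "measure_pmf (bernoulli_pmf (1 / 2))"
  interpret P: pair_prob_space fair_tree fair_tree ..
  interpret Q: pair_prob_space ?C "fair_tree \<Otimes>\<^sub>M fair_tree" ..
  let ?f = "\<lambda>t. F (t []) (subtree False t) * G (t []) (subtree True t)"
  have m: "?f \<in> borel_measurable fair_tree"
    by (intro borel_measurable_times measurable_root_subtree F G)
  have bnd: "\<bar>F c s * G c t\<bar> \<le> C * D" for c s t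
    unfolding abs_mult using F(2)[of c s] G(2)[of c t] by (intro mult_mono) auto
  have int1: "integrable graft_law (\<lambda>x. ?f (graft x))"
    by (rule Q.integrable_const_bound[of _ "C * D"])
       (use bnd measurable_compose[OF measurable_graft m] in auto)
  have int2: "integrable (fair_tree \<Otimes>\<^sub>M fair_tree) (\<lambda>x. F c (fst x) * G c (snd x))" for c
    by (rule P.integrable_const_bound[of _ "C * D"])
       (use bnd in \<open>auto intro!: borel_measurable_times measurable_compose[OF measurable_fst F(1)]
          measurable_compose[OF measurable_snd G(1)]\<close>)
  have inner: "(\<integral>x. F c (fst x) * G c (snd x) \<partial>(fair_tree \<Otimes>\<^sub>M fair_tree))
      = (\<integral>t. F c t \<partial>fair_tree) * (\<integral>t. G c t \<partial>fair_tree)" for c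
    by (subst P.integral_fst'[OF int2, symmetric]) simp
  have "(\<integral>t. ?f t \<partial>fair_tree) = (\<integral>x. ?f (graft x) \<partial>graft_law)"
    by (subst (1) distr_graft[symmetric], rule integral_distr[OF measurable_graft m])
  also have "\<dots> = (\<integral>c. (\<integral>x. ?f (graft (c, x)) \<partial>(fair_tree \<Otimes>\<^sub>M fair_tree)) \<partial>?C)"
    by (rule Q.integral_fst'[OF int1, symmetric])
  also have "\<dots> = (\<integral>c. (\<integral>t. F c t \<partial>fair_tree) * (\<integral>t. G c t \<partial>fair_tree) \<partial>?C)"
    unfolding inner[symmetric]
    by (intro Bochner_Integration.integral_cong refl) (auto simp: graft_simps)
  also have "\<dots> = (\<Sum>c\<in>UNIV. (\<integral>t. F c t \<partial>fair_tree) * (\<integral>t. G c t \<partial>fair_tree)) / 2"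
    by (simp add: UNIV_bool)
  finally show ?thesis .
qed

text \<open>
  The given random signs are indexed by level and position; reading a node as such a pair shows
  that their joint law is the law of the fair tree. Hence almost sure statements need to be proved
  for the fair tree only.
\<close>

lemma AE_fair_tree_transfer:
  fixes \<omega> :: "nat \<Rightarrow> nat \<Rightarrow> 'a \<Rightarrow> real"
  assumes "prob_space M"
    and ind: "prob_space.indep_vars M (\<lambda>_. borel) (\<lambda>(n, j). \<omega> n j) (SIGMA n:UNIV. {..<2 ^ n})"
    and one: "\<And>n j. j < 2 ^ n \<Longrightarrow> measure M {w \<in> space M. \<omega> n j w = 1} = 1 / 2"
    and P: "AE t in fair_tree. P t"
  shows "AE w in M. P (coins (\<lambda>n j. \<omega> n j w))"
proof -
  interpret prob_space M by fact
  let ?C = "measure_pmf (bernoulli_pmf (1 / 2))"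
  let ?K = "SIGMA n:UNIV. {..<2 ^ n :: nat}"
  define X where "X = (\<lambda>(n, j) w. \<omega> n j w = 1)"
  define a where "a = (\<lambda>l. (length l, address l))"
  have indX: "indep_vars (\<lambda>_. count_space UNIV) X ?K"
    using indep_vars_compose2[OF ind, of "\<lambda>_ x. x = 1" "\<lambda>_. count_space UNIV"]
    by (simp add: X_def case_prod_beta')
  have rv: "X i \<in> M \<rightarrow>\<^sub>M count_space UNIV" if "i \<in> ?K" for i
    using indX that unfolding indep_vars_def by blast
  have law: "distr M (count_space UNIV) (X i) = ?C" if i: "i \<in> ?K" for i
  proof (rule measure_eqI_countable[of _ UNIV])
    obtain n j where nj: "i = (n, j)" "j < 2 ^ n" using i by auto
    have t: "prob {w \<in> space M. X i w} = 1 / 2" using one nj by (simp add: X_def)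
    have ev: "{w \<in> space M. X i w} \<in> events"
      using measurable_sets[OF rv[OF i], of "{True}"] by (simp add: vimage_def Int_def conj_commute)
    have "prob (space M - {w \<in> space M. X i w}) = 1 / 2"
      using prob_compl[OF ev] t by simp
    moreover have "space M - {w \<in> space M. X i w} = {w \<in> space M. \<not> X i w}" by auto
    ultimately have f: "prob {w \<in> space M. \<not> X i w} = 1 / 2" by simp
    fix b :: bool
    have "emeasure (distr M (count_space UNIV) (X i)) {b} = emeasure M (X i -` {b} \<inter> space M)"
      by (rule emeasure_distr[OF rv[OF i]]) simp
    also have "X i -` {b} \<inter> space M = (if b then {w \<in> space M. X i w} else {w \<in> space M. \<not> X i w})"
      by auto
    also have "emeasure M \<dots> = ennreal (1 / 2)" by (simp only: emeasure_eq_measure t f if_cancel split: if_split) simp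
    finally show "emeasure (distr M (count_space UNIV) (X i)) {b} = emeasure ?C {b}"
      by (cases b) (simp_all add: emeasure_pmf_single)
  qed auto
  have a_K: "a l \<in> ?K" for l by (simp add: a_def address_less)
  then have K: "?K \<noteq> {}" by blast
  have inj: "inj_on a UNIV" unfolding a_def inj_on_def using address_inj by auto
  let ?X = "\<lambda>w. \<lambda>i\<in>?K. X i w"
  let ?r = "\<lambda>x. \<lambda>l\<in>UNIV. x (a l)"
  have "distr M (\<Pi>\<^sub>M i\<in>?K. count_space UNIV) ?X = (\<Pi>\<^sub>M i\<in>?K. distr M (count_space UNIV) (X i))"
    using indX by (subst (asm) indep_vars_iff_distr_eq_PiM'[OF K]) (use rv in auto)
  also have "\<dots> = (\<Pi>\<^sub>M i\<in>?K. ?C)" by (intro PiM_cong law) auto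
  also have "distr M (\<Pi>\<^sub>M i\<in>?K. count_space UNIV) ?X = distr M (\<Pi>\<^sub>M i\<in>?K. ?C) ?X"
    by (intro distr_cong sets_PiM_cong) auto
  finally have D1: "distr M (\<Pi>\<^sub>M i\<in>?K. ?C) ?X = (\<Pi>\<^sub>M i\<in>?K. ?C)" .
  have D2: "distr (\<Pi>\<^sub>M i\<in>?K. ?C) fair_tree ?r = fair_tree"
    unfolding fair_tree_def
    by (rule distr_PiM_reindex[OF _ inj]) (use a_K measure_pmf.prob_space_axioms in auto)
  have mX: "?X \<in> M \<rightarrow>\<^sub>M (\<Pi>\<^sub>M i\<in>?K. ?C)"
    by (intro measurable_restrict) (use rv in auto)
  have mr: "?r \<in> (\<Pi>\<^sub>M i\<in>?K. ?C) \<rightarrow>\<^sub>M fair_tree"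
    unfolding fair_tree_def by (intro measurable_restrict measurable_component_singleton a_K)
  have D: "distr M fair_tree (?r \<circ> ?X) = fair_tree"
    unfolding distr_distr[OF mr mX, symmetric] D1 D2 ..
  have "AE w in M. P ((?r \<circ> ?X) w)"
    by (rule AE_distrD[OF measurable_comp[OF mX mr]]) (use P in \<open>simp only: D\<close>)
  moreover have "(?r \<circ> ?X) w = coins (\<lambda>n j. \<omega> n j w)" for w
    using a_K by (auto simp: fun_eq_iff coins_def X_def a_def)
  ultimately show ?thesis by simp
qed

section \<open>Types of intervals and their offspring\<close>

definition kind :: "int \<times> int \<Rightarrow> nat option" where
  "kind s = (if alive s then Some (slope s) else None)"

text \<open>
  Sum over the two values of the root coin of a symmetric function of the types of both children
  (\<open>None\<close> is a dead child). A live interval of slope 0 has two live children of slope 1. One of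
  slope \<open>k > 0\<close> has a live child at its zero endpoint, whose slope is \<open>k + 1\<close> or \<open>k - 1\<close> with
  equal probability. Its other child is alive only if \<open>k = 1\<close> and the slope at the zero endpoint
  drops to 0, and then has slope 2.
\<close>

lemma offspring_sum:
  fixes H :: "nat option \<Rightarrow> nat option \<Rightarrow> real"
  assumes comm: "\<And>a b. H a b = H b a" and s: "alive s"
  shows "(\<Sum>c\<in>UNIV. H (kind (child False c s)) (kind (child True c s))) =
    (if slope s = 0 then 2 * H (Some 1) (Some 1)
     else if slope s = 1 then H (Some 2) None + H (Some 0) (Some 2)
     else H (Some (slope s + 1)) None + H (Some (slope s - 1)) None)"
proof -
  obtain A B where AB: "s = (A, B)" by (cases s)
  define k where "k = A + B"
  have k: "slope s = nat \<bar>k\<bar>" by (simp add: AB slope_def k_def)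
  have near: "kind (0, k + d) = Some (nat \<bar>k + d\<bar>)" "kind (k + d, 0) = Some (nat \<bar>k + d\<bar>)" for d
    by (simp_all add: kind_def slope_def)
  have far: "kind (k + d, 2 * k) = (if k = 0 then Some (nat \<bar>d\<bar>) else if k + d = 0 then Some (nat \<bar>2 * k\<bar>) else None)"
    "kind (2 * k, k + d) = (if k = 0 then Some (nat \<bar>d\<bar>) else if k + d = 0 then Some (nat \<bar>2 * k\<bar>) else None)" for d
    by (auto simp: kind_def slope_def)
  have st: "s = (0, k) \<or> s = (k, 0)" using s by (auto simp: AB k_def)
  consider "k = 0" | "k = 1" | "k = -1" | "k \<ge> 2" | "k \<le> -2" by linarith
  then show ?thesis
  proof cases
    case 4
    then have "nat \<bar>k + 1\<bar> = nat \<bar>k\<bar> + 1" "nat \<bar>k - 1\<bar> = nat \<bar>k\<bar> - 1" by linarith+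
    then show ?thesis using st 4 near[of 1] near[of "-1"] far[of 1] far[of "-1"] comm
      by (auto simp: k UNIV_bool spin_def)
  next
    case 5
    then have "nat \<bar>k + 1\<bar> = nat \<bar>k\<bar> - 1" "nat \<bar>k - 1\<bar> = nat \<bar>k\<bar> + 1" by linarith+
    then show ?thesis using st 5 near[of 1] near[of "-1"] far[of 1] far[of "-1"] comm
      by (auto simp: k UNIV_bool spin_def)
  qed (use st comm in \<open>auto simp: k UNIV_bool spin_def kind_def slope_def\<close>)
qed

section \<open>The expected number of live intervals\<close>

definition population :: "nat \<Rightarrow> (bool list \<Rightarrow> bool) \<Rightarrow> int \<times> int \<Rightarrow> real" where
  "population n t s = card (live_set n t s)"

lemma live_set_Suc:
  "live_set (Suc n) t s = (if alive s then \<Union>b. (#) b ` live_set n (subtree b t) (child b (t []) s) else {})"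
proof -
  have "l \<in> live_set (Suc n) t s \<longleftrightarrow>
    l \<in> (if alive s then \<Union>b. (#) b ` live_set n (subtree b t) (child b (t []) s) else {})" for l
    by (cases l) (auto simp: live_set_def)
  then show ?thesis by blast
qed

lemma population_0: "population 0 t s = of_bool (alive s)"
proof -
  have "live_set 0 t s = (if alive s then {[]} else {})" by (auto simp: live_set_def)
  then show ?thesis by (simp add: population_def)
qed

lemma population_Suc:
  "population (Suc n) t s = (if alive s then population n (subtree False t) (child False (t []) s)
     + population n (subtree True t) (child True (t []) s) else 0)"
proof (cases "alive s")
  case True
  let ?L = "\<lambda>b. (#) b ` live_set n (subtree b t) (child b (t []) s)"
  have "live_set (Suc n) t s = ?L False \<union> ?L True"
    using True by (simp add: live_set_Suc UNIV_bool Un_commute)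
  then have "card (live_set (Suc n) t s) = card (?L False) + card (?L True)"
    by (simp only:, intro card_Un_disjoint) (auto simp: finite_live_set)
  then show ?thesis using True by (simp add: population_def card_image)
qed (simp add: population_def live_set_Suc)

lemma population_bounds: "0 \<le> population n t s" "population n t s \<le> 2 ^ n"
proof -
  show "0 \<le> population n t s" by (simp add: population_def)
  show "population n t s \<le> 2 ^ n"
  proof (induction n arbitrary: t s)
    case (Suc n)
    have "population n (subtree False t) (child False (t []) s)
        + population n (subtree True t) (child True (t []) s) \<le> 2 ^ n + 2 ^ n"
      by (intro add_mono Suc)
    then show ?case by (simp add: population_Suc)
  qed (simp add: population_0)
qed

lemma measurable_population: "(\<lambda>t. population n t s) \<in> borel_measurable fair_tree"
proof (induction n arbitrary: s)
  case (Suc n)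
  have "(\<lambda>t. population n (subtree b t) (child b (t []) s)) \<in> borel_measurable fair_tree" for b
    using measurable_root_subtree[of "\<lambda>c t. population n t (child b c s)"] Suc by simp
  then show ?case by (auto simp: population_Suc)
qed (simp add: population_0)

definition mean_population :: "nat \<Rightarrow> int \<times> int \<Rightarrow> real" where
  "mean_population n s = (\<integral>t. population n t s \<partial>fair_tree)"

lemma mean_population_Suc:
  assumes "alive s"
  shows "mean_population (Suc n) s =
    (\<Sum>c\<in>UNIV. mean_population n (child False c s) + mean_population n (child True c s)) / 2"
proof -
  have b: "\<bar>population n t s\<bar> \<le> 2 ^ n" for t s using population_bounds[of n t s] by simp
  have m: "integrable fair_tree (\<lambda>t. population n (subtree b t) (child b (t []) s))" for b
    by (rule bounded_integrable[OF _ b])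
       (rule measurable_root_subtree[of "\<lambda>c t. population n t (child b c s)"], rule measurable_population)
  have "mean_population (Suc n) s = (\<integral>t. population n (subtree False t) (child False (t []) s) \<partial>fair_tree)
    + (\<integral>t. population n (subtree True t) (child True (t []) s) \<partial>fair_tree)"
    using assms m[of False] m[of True] by (simp add: mean_population_def population_Suc)
  also have "(\<integral>t. population n (subtree False t) (child False (t []) s) \<partial>fair_tree)
      = (\<Sum>c\<in>UNIV. mean_population n (child False c s)) / 2"
    using integral_split_root[of "\<lambda>c t. population n t (child False c s)" "2 ^ n" "\<lambda>_ _. 1" 1]
      measurable_population b fair_tree.prob_space by (simp add: mean_population_def)
  also have "(\<integral>t. population n (subtree True t) (child True (t []) s) \<partial>fair_tree)
      = (\<Sum>c\<in>UNIV. mean_population n (child True c s)) / 2"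
    using integral_split_root[of "\<lambda>_ _. 1" 1 "\<lambda>c t. population n t (child True c s)" "2 ^ n"]
      measurable_population b fair_tree.prob_space by (simp add: mean_population_def)
  finally show ?thesis by (simp add: sum.distrib add_divide_distrib)
qed

lemma mean_population_0: "mean_population 0 s = of_bool (alive s)"
  using fair_tree.prob_space by (simp add: mean_population_def population_0)

lemma mean_population_dead: "\<not> alive s \<Longrightarrow> mean_population n s = 0"
  by (cases n) (simp_all add: mean_population_0, simp add: mean_population_def population_Suc)

text \<open>
  For \<open>x < 1\<close>, the functions \<open>h\<close> on the positive integers with
  \<open>h k = x * (h (k - 1) + h (k + 1)) / 2\<close> for \<open>k \<ge> 2\<close> are spanned by two geometric
  progressions. Their ratios are the roots of a quadratic equation with product 1, and \<open>g\<close> is the smaller one.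
\<close>

lemma decay_root:
  fixes x :: real
  assumes x: "0 < x" "x \<le> 1"
  defines "g \<equiv> (1 - sqrt (1 - x\<^sup>2)) / x"
  shows "0 \<le> g" "g \<le> 1" "x * (1 + g\<^sup>2) / 2 = g" "x * g = 1 - sqrt (1 - x\<^sup>2)"
proof -
  define q where "q = sqrt (1 - x\<^sup>2)"
  have x2: "x\<^sup>2 \<le> 1" using x by (simp add: power_le_one)
  have q2: "q\<^sup>2 = 1 - x\<^sup>2" unfolding q_def using x2 by simp
  have q: "0 \<le> q" "q \<le> 1" unfolding q_def using x x2 by auto
  have g: "x * g = 1 - q" unfolding g_def q_def using x by simp
  show "x * g = 1 - sqrt (1 - x\<^sup>2)" using g by (simp add: q_def)
  show "0 \<le> g" unfolding g_def using q x by (simp add: q_def)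
  have "(1 - q) * (1 - q) \<le> (1 - q) * (1 + q)" using q by (intro mult_left_mono) auto
  then have "(1 - q)\<^sup>2 \<le> x\<^sup>2" using q2 by (simp add: power2_eq_square algebra_simps)
  then have "1 - q \<le> x" using x by (simp add: abs_le_square_iff[symmetric])
  then show "g \<le> 1" unfolding g_def using x by (simp add: q_def)
  have "x\<^sup>2 * (1 + g\<^sup>2) = x\<^sup>2 + (x * g)\<^sup>2" by (simp add: algebra_simps power_mult_distrib)
  also have "\<dots> = 2 * (x * g)" unfolding g using q2 by (simp add: power2_eq_square algebra_simps)
  finally have "x * (x * (1 + g\<^sup>2)) = x * (2 * g)" by (simp add: power2_eq_square algebra_simps)
  then show "x * (1 + g\<^sup>2) / 2 = g" using x by simp
qed

lemma geometric_step:
  fixes g :: real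
  assumes "x * (1 + g\<^sup>2) / 2 = g" "2 \<le> k"
  shows "x * (g ^ (k - 2) + g ^ k) / 2 = g ^ (k - 1)"
proof -
  obtain m where "k = Suc (Suc m)" using assms(2) by (metis add_2_eq_Suc le_Suc_ex)
  then show ?thesis
    using arg_cong[OF assms(1), of "\<lambda>z. z * g ^ m"] by (simp add: algebra_simps power2_eq_square)
qed

text \<open>
  The mean offspring operator, with weight \<open>x\<close> for each level, acts on functions \<open>w\<close> of the type.
  On \<open>w k = g ^ (k - 1)\<close> for \<open>k > 0\<close> and \<open>w 0 = 2 x\<close> it reproduces \<open>w\<close> except at \<open>k = 1\<close>,
  where it gives \<open>x\<^sup>2 + x * g = x\<^sup>2 + 1 - sqrt (1 - x\<^sup>2)\<close>. This is less than 1 exactly if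
  \<open>x ^ 4 + x\<^sup>2 < 1\<close>, and the slack leaves room for adding a constant, which bounds \<open>w\<close> away
  from 0.
\<close>

lemma supersolution_exists:
  fixes x :: real
  assumes x: "0 < x" "x ^ 4 + x\<^sup>2 < 1"
  obtains w :: "nat \<Rightarrow> real" and c where "0 < c" "\<And>k. c \<le> w k" "2 * x * w 1 \<le> w 0"
    "x * (w 0 / 2 + w 2) \<le> w 1" "\<And>k. 2 \<le> k \<Longrightarrow> x * (w (k - 1) + w (k + 1)) / 2 \<le> w k"
proof -
  have x1: "x < 1"
  proof (rule ccontr)
    assume "\<not> x < 1"
    then have "1 \<le> x\<^sup>2" by (simp add: one_le_power)
    then show False using x zero_le_power[of x 4] by linarith
  qed
  define g where "g = (1 - sqrt (1 - x\<^sup>2)) / x"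
  note g = decay_root[OF x(1), folded g_def]
  have "(x\<^sup>2)\<^sup>2 < 1 - x\<^sup>2" using x by simp
  then have "x\<^sup>2 < sqrt (1 - x\<^sup>2)" using real_less_rsqrt by blast
  then have m: "x\<^sup>2 + x * g < 1" using g(4) x1 by simp
  \<comment> \<open>Adding a constant costs at most twice that constant at slope 1, which the slack pays for.\<close>
  define \<epsilon> where "\<epsilon> = (1 - (x\<^sup>2 + x * g)) / 2"
  have e: "0 < \<epsilon>" "x\<^sup>2 + x * g = 1 - 2 * \<epsilon>" using m by (auto simp: \<epsilon>_def field_simps)
  define w where "w k = (if k = 0 then 2 * x * (1 + \<epsilon>) else g ^ (k - 1) + \<epsilon>)" for k
  have g0: "0 \<le> g" using g x1 by simp
  show ?thesis
  proof (rule that[of "min \<epsilon> (2 * x)" w])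
    show "0 < min \<epsilon> (2 * x)" using e x by simp
    show "min \<epsilon> (2 * x) \<le> w k" for k
    proof (cases "k = 0")
      case True
      have "2 * x \<le> 2 * x * (1 + \<epsilon>)" using x e by (simp add: algebra_simps)
      then show ?thesis using True by (simp add: w_def)
    qed (simp add: w_def g0 min.coboundedI1)
    show "2 * x * w 1 \<le> w 0" by (simp add: w_def)
    have "x\<^sup>2 \<le> 1" using x1 x(1) by (simp add: power_le_one)
    then have "x\<^sup>2 * \<epsilon> \<le> 1 * \<epsilon>" using e by (intro mult_right_mono) auto
    moreover have "x * \<epsilon> \<le> 1 * \<epsilon>" using x1 e by (intro mult_right_mono) auto
    moreover have "x * (w 0 / 2 + w 2) = (x\<^sup>2 + x * g) + x\<^sup>2 * \<epsilon> + x * \<epsilon>"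
      by (simp add: w_def algebra_simps power2_eq_square)
    ultimately have "x * (w 0 / 2 + w 2) \<le> 1 + \<epsilon> - \<epsilon> + \<epsilon>" using e by linarith
    then show "x * (w 0 / 2 + w 2) \<le> w 1" by (simp add: w_def)
    show "x * (w (k - 1) + w (k + 1)) / 2 \<le> w k" if k: "2 \<le> k" for k
    proof -
      have "x * (w (k - 1) + w (k + 1)) / 2 = x * (g ^ (k - 2) + g ^ k) / 2 + x * \<epsilon>"
        using k by (simp add: w_def algebra_simps numeral_2_eq_2 Suc_diff_Suc)
      also have "\<dots> = g ^ (k - 1) + x * \<epsilon>" using geometric_step[OF g(3) k] x1 by simp
      also have "x * \<epsilon> \<le> 1 * \<epsilon>" using x1 e by (intro mult_right_mono) auto
      finally show ?thesis using k by (simp add: w_def)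
    qed
  qed
qed

text \<open>
  Beyond the critical value \<open>x ^ 4 + x\<^sup>2 = 1\<close> the same function grows at \<open>k = 1\<close> under the
  linear operator. The percolation recursion differs from the linear one by quadratic terms, and
  these occur for \<open>k = 0\<close> and \<open>k = 1\<close> only; hence a small multiple, slightly lowered at 0, is a
  subsolution.
\<close>

lemma subsolution_exists:
  fixes r :: real
  assumes r: "0 < r" "r < 1" "1 < r ^ 4 + r\<^sup>2"
  obtains w :: "nat \<Rightarrow> real" where "\<And>k. 0 \<le> w k" "\<And>k. w k \<le> 1" "0 < w 1"
    "w 0 \<le> 1 - (1 - r * w 1)\<^sup>2"
    "w 1 \<le> (r * w 2 + (1 - (1 - r * w 0) * (1 - r * w 2))) / 2"
    "\<And>k. 2 \<le> k \<Longrightarrow> w k \<le> r * (w (k - 1) + w (k + 1)) / 2"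
proof -
  define g where "g = (1 - sqrt (1 - r\<^sup>2)) / r"
  note g = decay_root[OF r(1) less_imp_le[OF r(2)], folded g_def]
  have r2: "r\<^sup>2 < 1" using r by (simp add: power_less_one_iff)
  have "1 - r\<^sup>2 < (r\<^sup>2)\<^sup>2" using r by simp
  then have "sqrt (1 - r\<^sup>2) < r\<^sup>2" by (intro real_less_lsqrt) auto
  then have m: "1 < r\<^sup>2 + r * g" using g(4) by simp
  have "r * g \<le> 1" using g(4) r2 by simp
  define \<epsilon> where "\<epsilon> = (r\<^sup>2 + r * g - 1) / 2"
  have e: "0 < \<epsilon>" "\<epsilon> < 1 / 2" "r\<^sup>2 + r * g = 1 + 2 * \<epsilon>"
    using m r2 \<open>r * g \<le> 1\<close> by (auto simp: \<epsilon>_def field_simps)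
  define w where "w k = (if k = 0 then 2 * r * (1 - \<epsilon>) * \<epsilon> else \<epsilon> * g ^ (k - 1))" for k
  have bounds: "0 \<le> w k \<and> w k \<le> 1" for k
  proof (cases "k = 0")
    case True
    have "r * (1 - \<epsilon>) * (2 * \<epsilon>) \<le> 1 * 1 * 1" using r e by (intro mult_mono) auto
    then show ?thesis using True r e by (simp add: w_def mult_ac)
  next
    case False
    have "\<epsilon> * g ^ (k - 1) \<le> 1 * 1" using g e by (intro mult_mono power_le_one) auto
    then show ?thesis using False e g by (simp add: w_def)
  qed
  show ?thesis
  proof (rule that[of w])
    show "0 \<le> w k" "w k \<le> 1" for k using bounds by auto
    show "0 < w 1" using e by (simp add: w_def)
    have "r * (r * \<epsilon>\<^sup>2) \<le> r * (2 * \<epsilon>\<^sup>2)" using r by (intro mult_left_mono mult_right_mono) auto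
    then show "w 0 \<le> 1 - (1 - r * w 1)\<^sup>2"
      by (simp add: w_def power2_eq_square algebra_simps)
    have e1: "1 - \<epsilon> \<le> 1" "0 \<le> 1 - \<epsilon>" "\<epsilon> \<le> 1" using e by linarith+
    have "r\<^sup>2 * \<epsilon> \<le> 1 * \<epsilon>" using r2 e by (intro mult_right_mono) auto
    moreover have "r\<^sup>2 * ((r * g) * ((1 - \<epsilon>) * \<epsilon>)) \<le> 1 * (1 * (1 * \<epsilon>))"
      using r2 g(1) r(1) e(1) e1 \<open>r * g \<le> 1\<close> by (intro mult_mono) auto
    ultimately have "1 \<le> (r\<^sup>2 + r * g) - r\<^sup>2 * \<epsilon> - r\<^sup>2 * ((r * g) * ((1 - \<epsilon>) * \<epsilon>))"
      unfolding e(3) by linarith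
    then have "\<epsilon> * 1 \<le> \<epsilon> * ((r\<^sup>2 + r * g) - r\<^sup>2 * \<epsilon> - r\<^sup>2 * ((r * g) * ((1 - \<epsilon>) * \<epsilon>)))"
      using e by (intro mult_left_mono) auto
    also have "\<dots> = (r * w 2 + (1 - (1 - r * w 0) * (1 - r * w 2))) / 2"
      by (simp add: w_def algebra_simps power2_eq_square)
    finally show "w 1 \<le> (r * w 2 + (1 - (1 - r * w 0) * (1 - r * w 2))) / 2" by (simp add: w_def)
    show "w k \<le> r * (w (k - 1) + w (k + 1)) / 2" if k: "2 \<le> k" for k
    proof -
      have "r * (w (k - 1) + w (k + 1)) / 2 = \<epsilon> * (r * (g ^ (k - 2) + g ^ k) / 2)"
        using k by (simp add: w_def algebra_simps numeral_2_eq_2 Suc_diff_Suc)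
      then show ?thesis using geometric_step[OF g(3) k] k by (simp add: w_def)
    qed
  qed
qed

text \<open>
  The supersolution dominates the rescaled expected population by induction on the level.
\<close>

lemma mean_population_bound:
  assumes x: "0 < x" "x ^ 4 + x\<^sup>2 < (1::real)"
  shows "\<exists>K. \<forall>n. mean_population n (0, 0) * x ^ n \<le> K"
proof -
  obtain w :: "nat \<Rightarrow> real" and c where c: "0 < c" "\<And>k. c \<le> w k" and w: "2 * x * w 1 \<le> w 0"
    "x * (w 0 / 2 + w 2) \<le> w 1" "\<And>k. 2 \<le> k \<Longrightarrow> x * (w (k - 1) + w (k + 1)) / 2 \<le> w k"
    using supersolution_exists[OF x] by metis
  define W where "W = case_option 0 w"
  have "c * (mean_population n s * x ^ n) \<le> W (kind s)" for n s
  proof (induction n arbitrary: s)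
    case 0
    then show ?case using c by (auto simp: mean_population_0 W_def kind_def)
  next
    case (Suc n)
    show ?case
    proof (cases "alive s")
      case True
      let ?a = "\<lambda>b c'. c * (mean_population n (child b c' s) * x ^ n)"
      have "c * (mean_population (Suc n) s * x ^ Suc n) = x / 2 * (\<Sum>c'\<in>UNIV. ?a False c' + ?a True c')"
        unfolding mean_population_Suc[OF True]
        by (simp add: sum_distrib_left sum_distrib_right sum_divide_distrib algebra_simps sum.distrib)
      also have "\<dots> \<le> x / 2 * (\<Sum>c'\<in>UNIV. W (kind (child False c' s)) + W (kind (child True c' s)))"
        using x by (intro mult_left_mono sum_mono add_mono Suc) auto
      also have "\<dots> \<le> W (kind s)"
        using offspring_sum[of "\<lambda>a b. W a + W b", OF _ True] w True x(1)
          w(3)[of "slope s"]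
        by (auto simp: W_def kind_def[of s] algebra_simps)
      finally show ?thesis .
    qed (simp add: mean_population_dead W_def kind_def)
  qed
  then have "mean_population n (0, 0) * x ^ n \<le> W (kind (0, 0)) / c" for n
    unfolding pos_le_divide_eq[OF c(1)] by (subst mult.commute)
  then show ?thesis by blast
qed

text \<open>
  The population weighted with \<open>x < y\<close> decays geometrically in mean, so that its sum over all levels
  has a finite mean and is almost surely finite.
\<close>

lemma population_decay:
  assumes xy: "0 < x" "x < y" and y: "y ^ 4 + y\<^sup>2 < (1::real)"
  shows "AE t in fair_tree. (\<lambda>n. population n t (0, 0) * x ^ n) \<longlonglongrightarrow> 0"
proof -
  obtain K where K: "\<And>n. mean_population n (0, 0) * y ^ n \<le> K"
    using mean_population_bound[of y] xy y by auto
  define u where "u n t = population n t (0, 0) * x ^ n" for n t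
  have u: "0 \<le> u n t" "\<bar>u n t\<bar> \<le> 2 ^ n * x ^ n" for n t
    using population_bounds[of n t "(0, 0)"] xy by (auto simp: u_def abs_mult)
  have mu: "u n \<in> borel_measurable fair_tree" for n
    unfolding u_def using measurable_population by simp
  have K0: "0 \<le> K"
    using K[of 0] by (simp add: mean_population_0)
  have mean: "(\<integral>t. u n t \<partial>fair_tree) \<le> K * (x / y) ^ n" for n
  proof -
    have "(\<integral>t. u n t \<partial>fair_tree) = (mean_population n (0, 0) * y ^ n) * (x / y) ^ n"
      using xy by (simp add: u_def mean_population_def power_divide)
    also have "\<dots> \<le> K * (x / y) ^ n" using K xy by (intro mult_right_mono) auto
    finally show ?thesis .
  qed
  have "(\<integral>\<^sup>+t. (\<Sum>n. ennreal (u n t)) \<partial>fair_tree) = (\<Sum>n. \<integral>\<^sup>+t. ennreal (u n t) \<partial>fair_tree)"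
    using mu by (intro nn_integral_suminf) auto
  also have "\<dots> \<le> (\<Sum>n. ennreal (K * (x / y) ^ n))"
  proof (intro suminf_le summableI)
    fix n
    have "(\<integral>\<^sup>+t. ennreal (u n t) \<partial>fair_tree) = ennreal (\<integral>t. u n t \<partial>fair_tree)"
      using u by (intro nn_integral_eq_integral bounded_integrable[OF mu]) auto
    then show "(\<integral>\<^sup>+t. ennreal (u n t) \<partial>fair_tree) \<le> ennreal (K * (x / y) ^ n)"
      using mean by (simp add: ennreal_leI)
  qed
  also have "\<dots> < \<infinity>"
    using xy K0 by (subst suminf_ennreal2) (auto intro!: summable_mult summable_geometric simp: ennreal_less_top)
  finally have "AE t in fair_tree. (\<Sum>n. ennreal (u n t)) \<noteq> \<infinity>"
    using mu by (intro nn_integral_noteq_infinite) auto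
  then show ?thesis
  proof (rule AE_mp, intro AE_I2 impI)
    fix t assume "(\<Sum>n. ennreal (u n t)) \<noteq> \<infinity>"
    then have "summable (\<lambda>n. u n t)"
      using u(1) by (intro summable_suminf_not_top) (auto simp: top_ennreal_def[symmetric] infinity_ennreal_def)
    then show "(\<lambda>n. population n t (0, 0) * x ^ n) \<longlonglongrightarrow> 0"
      using summable_LIMSEQ_zero by (auto simp: u_def)
  qed
qed

section \<open>Percolation on the live tree\<close>

text \<open>
  Suppose that every edge of the tree of live intervals is kept independently with probability
  \<open>r\<close>. For a fixed tree \<open>t\<close>, \<open>percolation r n t s\<close> is the probability that the root remains
  connected to a live interval of level \<open>n\<close>. Only this recursion is used, so the percolation itself
  need not be constructed.
\<close>

primrec percolation :: "real \<Rightarrow> nat \<Rightarrow> (bool list \<Rightarrow> bool) \<Rightarrow> int \<times> int \<Rightarrow> real" where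
  "percolation r 0 t s = of_bool (alive s)"
| "percolation r (Suc n) t s = (if alive s then
     1 - (1 - r * percolation r n (subtree False t) (child False (t []) s))
       * (1 - r * percolation r n (subtree True t) (child True (t []) s)) else 0)"

definition percolation_limit :: "real \<Rightarrow> (bool list \<Rightarrow> bool) \<Rightarrow> int \<times> int \<Rightarrow> real" where
  "percolation_limit r t s = lim (\<lambda>n. percolation r n t s)"

text \<open>
  The probability that the tree, started in state \<open>s\<close>, is too thin for percolation with
  parameter \<open>r\<close>.
\<close>

definition extinction :: "real \<Rightarrow> int \<times> int \<Rightarrow> real" where
  "extinction r s = (\<integral>t. of_bool (percolation_limit r t s = 0) \<partial>fair_tree)"

lemma union_prob_bounds:
  fixes a b :: real
  assumes "0 \<le> a" "a \<le> 1" "0 \<le> b" "b \<le> 1"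
  shows "0 \<le> 1 - (1 - a) * (1 - b)" "1 - (1 - a) * (1 - b) \<le> 1"
  using assms mult_mono[of "1 - a" 1 "1 - b" 1] by auto

lemma union_prob_mono:
  fixes a b :: real
  assumes "a \<le> a'" "a' \<le> 1" "b \<le> b'" "b' \<le> 1"
  shows "1 - (1 - a) * (1 - b) \<le> 1 - (1 - a') * (1 - b')"
  using assms mult_mono[of "1 - a'" "1 - a" "1 - b'" "1 - b"] by auto

context
  fixes r :: real
  assumes r: "0 < r" "r < 1"
begin

lemma percolation_bounds: "0 \<le> percolation r n t s" "percolation r n t s \<le> 1"
proof -
  have "0 \<le> percolation r n t s \<and> percolation r n t s \<le> 1"
  proof (induction n arbitrary: t s)
    case (Suc n)
    have "0 \<le> r * percolation r n t s" "r * percolation r n t s \<le> 1" for t s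
      using Suc[of t s] r by (auto intro: mult_le_one)
    then show ?case by (cases "alive s") (simp_all only: percolation.simps if_True if_False union_prob_bounds, simp_all)
  qed simp
  then show "0 \<le> percolation r n t s" "percolation r n t s \<le> 1" by auto
qed

lemma scaled_percolation_bounds: "0 \<le> r * percolation r n t s" "r * percolation r n t s \<le> 1"
  using percolation_bounds[of n t s] r by (auto intro: mult_le_one)

lemma percolation_dead: "\<not> alive s \<Longrightarrow> percolation r n t s = 0"
  by (cases n) auto

lemma percolation_Suc_le: "percolation r (Suc n) t s \<le> percolation r n t s"
proof (induction n arbitrary: t s)
  case 0
  then show ?case using percolation_bounds(2)[of 1 t s] by (cases "alive s") (auto simp del: percolation.simps(2) simp: percolation_dead)
next
  case (Suc n)
  show ?case
  proof (cases "alive s")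
    case True
    have "r * percolation r (Suc n) t s \<le> r * percolation r n t s" for t s
      using Suc r by (intro mult_left_mono) auto
    then show ?thesis
      unfolding percolation.simps(2)[of r "Suc n" t s] percolation.simps(2)[of r n t s]
      using True scaled_percolation_bounds by (simp add: union_prob_mono del: percolation.simps(2))
  qed simp
qed

lemma percolation_tendsto: "(\<lambda>n. percolation r n t s) \<longlonglongrightarrow> percolation_limit r t s"
proof -
  have "decseq (\<lambda>n. percolation r n t s)" by (rule decseq_SucI) (rule percolation_Suc_le)
  then have "convergent (\<lambda>n. percolation r n t s)"
    using percolation_bounds(1) by (metis decseq_convergent convergentI)
  then show ?thesis unfolding percolation_limit_def by (simp add: convergent_LIMSEQ_iff)
qed

lemma percolation_limit_bounds: "0 \<le> percolation_limit r t s" "percolation_limit r t s \<le> 1"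
  by (rule LIMSEQ_le_const[OF percolation_tendsto], simp add: percolation_bounds)
     (rule LIMSEQ_le_const2[OF percolation_tendsto], simp add: percolation_bounds)

lemma percolation_limit_le: "percolation_limit r t s \<le> percolation r n t s"
  by (rule decseq_ge[OF decseq_SucI percolation_tendsto]) (rule percolation_Suc_le)

lemma percolation_limit_split:
  assumes "alive s"
  shows "percolation_limit r t s =
     1 - (1 - r * percolation_limit r (subtree False t) (child False (t []) s))
       * (1 - r * percolation_limit r (subtree True t) (child True (t []) s))"
proof (rule LIMSEQ_unique)
  show "(\<lambda>n. percolation r (Suc n) t s) \<longlonglongrightarrow> percolation_limit r t s"
    by (rule LIMSEQ_Suc[OF percolation_tendsto])
  show "(\<lambda>n. percolation r (Suc n) t s) \<longlonglongrightarrow>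
     1 - (1 - r * percolation_limit r (subtree False t) (child False (t []) s))
       * (1 - r * percolation_limit r (subtree True t) (child True (t []) s))"
    using assms by (simp, intro tendsto_intros percolation_tendsto)
qed

lemma percolation_limit_eq_0_iff:
  assumes "alive s"
  shows "percolation_limit r t s = 0 \<longleftrightarrow>
     percolation_limit r (subtree False t) (child False (t []) s) = 0
     \<and> percolation_limit r (subtree True t) (child True (t []) s) = 0"
proof -
  define a where "a = percolation_limit r (subtree False t) (child False (t []) s)"
  define b where "b = percolation_limit r (subtree True t) (child True (t []) s)"
  have a: "0 \<le> a" "a \<le> 1" and b: "0 \<le> b" "b \<le> 1"
    unfolding a_def b_def using percolation_limit_bounds by auto
  have "a = 0 \<and> b = 0" if "(1 - r * a) * (1 - r * b) = 1"
  proof -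
    have le: "0 \<le> r * a" "r * a \<le> 1" "0 \<le> r * b" "r * b \<le> 1"
      using a b r by (auto intro: mult_le_one)
    have "(1 - r * a) * (1 - r * b) \<le> 1 - r * a" "(1 - r * a) * (1 - r * b) \<le> 1 - r * b"
      using le by (auto intro: mult_left_le mult_left_le_one_le)
    then have "r * a = 0" "r * b = 0" using that le by auto
    then show ?thesis using r by simp
  qed
  then show ?thesis
    unfolding percolation_limit_split[OF assms, of t] a_def[symmetric] b_def[symmetric] by auto
qed

lemma measurable_percolation: "(\<lambda>t. percolation r n t s) \<in> borel_measurable fair_tree"
proof (induction n arbitrary: s)
  case (Suc n)
  have "(\<lambda>t. percolation r n (subtree b t) (child b (t []) s)) \<in> borel_measurable fair_tree" for b
    using measurable_root_subtree[of "\<lambda>c t. percolation r n t (child b c s)"] Suc by simp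
  then show ?case by (cases "alive s") auto
qed simp

lemma measurable_percolation_limit: "(\<lambda>t. percolation_limit r t s) \<in> borel_measurable fair_tree"
  by (rule borel_measurable_LIMSEQ_real[OF percolation_tendsto measurable_percolation])

lemma measurable_extinction:
  "(\<lambda>t. of_bool (percolation_limit r t s = 0) :: real) \<in> borel_measurable fair_tree"
proof -
  have "(\<lambda>t. if percolation_limit r t s = 0 then 1 else 0 :: real) \<in> borel_measurable fair_tree"
    using measurable_percolation_limit by measurable
  then show ?thesis by (simp add: of_bool_def)
qed

text \<open>
  A tree is too thin for percolation if and only if both subtrees are, and these are independent
  given the root coin.
\<close>

lemma extinction_split:
  assumes "alive s"
  shows "extinction r s = (\<Sum>c\<in>UNIV. extinction r (child False c s) * extinction r (child True c s)) / 2"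
  using integral_split_root[of "\<lambda>c t. of_bool (percolation_limit r t (child False c s) = 0)" 1
      "\<lambda>c t. of_bool (percolation_limit r t (child True c s) = 0)" 1] measurable_extinction
  by (simp add: extinction_def percolation_limit_eq_0_iff[OF assms] of_bool_conj)

lemma extinction_bounds: "0 \<le> extinction r s" "extinction r s \<le> 1"
proof -
  show "0 \<le> extinction r s" unfolding extinction_def by simp
  have "extinction r s \<le> (\<integral>t. 1 \<partial>fair_tree)"
    unfolding extinction_def
    by (intro integral_mono bounded_integrable[of _ 1] measurable_extinction) auto
  then show "extinction r s \<le> 1" using fair_tree.prob_space by simp
qed

definition mean_percolation :: "nat \<Rightarrow> int \<times> int \<Rightarrow> real" where
  "mean_percolation n s = (\<integral>t. percolation r n t s \<partial>fair_tree)"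

lemma integrable_percolation: "integrable fair_tree (\<lambda>t. percolation r n t s)"
  by (rule bounded_integrable[OF measurable_percolation, of _ _ 1]) (use percolation_bounds in auto)

lemma mean_percolation_bounds: "0 \<le> mean_percolation n s" "mean_percolation n s \<le> 1"
proof -
  show "0 \<le> mean_percolation n s" unfolding mean_percolation_def by (simp add: percolation_bounds)
  have "mean_percolation n s \<le> (\<integral>t. 1 \<partial>fair_tree)"
    unfolding mean_percolation_def by (intro integral_mono integrable_percolation percolation_bounds) auto
  then show "mean_percolation n s \<le> 1" using fair_tree.prob_space by simp
qed

lemma mean_percolation_Suc:
  assumes "alive s"
  shows "mean_percolation (Suc n) s =
    (\<Sum>c\<in>UNIV. 1 - (1 - r * mean_percolation n (child False c s)) * (1 - r * mean_percolation n (child True c s))) / 2"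
proof -
  let ?F = "\<lambda>b c t. 1 - r * percolation r n t (child b c s)"
  have F: "?F b c \<in> borel_measurable fair_tree" "\<bar>?F b c t\<bar> \<le> 1" for b c t
    using measurable_percolation scaled_percolation_bounds[of n t "child b c s"] by auto
  have mean: "(\<integral>t. ?F b c t \<partial>fair_tree) = 1 - r * mean_percolation n (child b c s)" for b c
    using integrable_percolation fair_tree.prob_space by (simp add: mean_percolation_def)
  have int: "integrable fair_tree (\<lambda>t. ?F False (t []) (subtree False t) * ?F True (t []) (subtree True t))"
  proof (rule bounded_integrable)
    show "(\<lambda>t. ?F False (t []) (subtree False t) * ?F True (t []) (subtree True t)) \<in> borel_measurable fair_tree"
      by (intro borel_measurable_times measurable_root_subtree F)
    show "\<bar>?F False (t []) (subtree False t) * ?F True (t []) (subtree True t)\<bar> \<le> 1" for t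
      using F(2) by (simp add: abs_mult mult_le_one)
  qed
  have "mean_percolation (Suc n) s =
      1 - (\<integral>t. ?F False (t []) (subtree False t) * ?F True (t []) (subtree True t) \<partial>fair_tree)"
    using assms int fair_tree.prob_space by (simp add: mean_percolation_def)
  also have "\<dots> = 1 - (\<Sum>c\<in>UNIV. (\<integral>t. ?F False c t \<partial>fair_tree) * (\<integral>t. ?F True c t \<partial>fair_tree)) / 2"
    by (subst integral_split_root[OF F F]) (rule refl)
  finally show ?thesis unfolding mean by (simp add: UNIV_bool field_simps)
qed

text \<open>
  A uniform lower bound for the mean percolation probabilities persists in the limit, and the
  limit can be at most the probability that it is nonzero.
\<close>

lemma extinction_le: "extinction r s \<le> 1 - a" if a: "\<And>n. a \<le> mean_percolation n s"
proof -
  have "(\<lambda>n. mean_percolation n s) \<longlonglongrightarrow> (\<integral>t. percolation_limit r t s \<partial>fair_tree)"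
    unfolding mean_percolation_def
    by (rule integral_dominated_convergence[where w = "\<lambda>_. 1"])
       (use percolation_tendsto percolation_bounds measurable_percolation measurable_percolation_limit in auto)
  then have "a \<le> (\<integral>t. percolation_limit r t s \<partial>fair_tree)"
    using a by (intro LIMSEQ_le_const) auto
  also have "\<dots> \<le> (\<integral>t. 1 - of_bool (percolation_limit r t s = 0) \<partial>fair_tree)"
    by (intro integral_mono bounded_integrable[of _ 1] borel_measurable_diff measurable_extinction
         measurable_percolation_limit) (use percolation_limit_bounds in auto)
  also have "\<dots> = 1 - extinction r s"
    using bounded_integrable[OF measurable_extinction, of _ 1] fair_tree.prob_space
    by (simp add: extinction_def)
  finally show ?thesis by simp
qed

text \<open>
  The mean of \<open>percolation\<close> satisfies a monotone recursion, so the subsolution, as a function of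
  the type, stays below it at every level.
\<close>

lemma mean_percolation_lower:
  assumes "1 < r ^ 4 + r\<^sup>2"
  obtains a where "0 < a" "\<And>n s. alive s \<Longrightarrow> slope s = 1 \<Longrightarrow> a \<le> mean_percolation n s"
proof -
  obtain w :: "nat \<Rightarrow> real" where w01: "\<And>k. 0 \<le> w k" "\<And>k. w k \<le> 1" and w1: "0 < w 1" and w:
    "w 0 \<le> 1 - (1 - r * w 1)\<^sup>2"
    "w 1 \<le> (r * w 2 + (1 - (1 - r * w 0) * (1 - r * w 2))) / 2"
    "\<And>k. 2 \<le> k \<Longrightarrow> w k \<le> r * (w (k - 1) + w (k + 1)) / 2"
    using subsolution_exists[OF r assms] by metis
  define W where "W = case_option 0 w"
  have "W (kind s) \<le> mean_percolation n s" for n s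
  proof (induction n arbitrary: s)
    case 0
    then show ?case using w01 fair_tree.prob_space
      by (auto simp: mean_percolation_def W_def kind_def)
  next
    case (Suc n)
    show ?case
    proof (cases "alive s")
      case True
      have "W (kind s) \<le> (\<Sum>c\<in>UNIV. 1 - (1 - r * W (kind (child False c s))) * (1 - r * W (kind (child True c s)))) / 2"
        using offspring_sum[of "\<lambda>a b. 1 - (1 - r * W a) * (1 - r * W b)", OF _ True] w(1,2) w(3)[of "slope s"] True
        by (auto simp: W_def kind_def[of s] algebra_simps power2_eq_square)
      also have "\<dots> \<le> mean_percolation (Suc n) s"
        unfolding mean_percolation_Suc[OF True] using Suc r mean_percolation_bounds
        by (intro divide_right_mono sum_mono union_prob_mono mult_left_mono mult_le_one) auto
      finally show ?thesis .
    qed (simp add: W_def kind_def mean_percolation_bounds)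
  qed
  then have "w 1 \<le> mean_percolation n s" if "alive s" "slope s = 1" for n s
    using that by (metis W_def kind_def option.simps(5))
  then show ?thesis using that[OF w1] by blast
qed

end

section \<open>Extinction has probability zero or one\<close>

text \<open>
  On the positive integers \<open>Q\<close> is convex and bounded, hence \<open>Q 2 \<le> Q 1\<close>. Then \<open>Q 1\<close> is at
  most \<open>(Q 1 + (Q 1) ^ 3) / 2\<close>, which forces \<open>Q 1 = 0\<close> unless \<open>Q 1 \<ge> 1\<close>.
\<close>

lemma bounded_subharmonic_zero:
  fixes Q :: "nat \<Rightarrow> real"
  assumes Q: "\<And>k. 0 \<le> Q k" "\<And>k. Q k \<le> 1" and lt: "Q 1 < 1"
    and Q0: "Q 0 \<le> Q 1 * Q 1" and Q1: "Q 1 \<le> (Q 2 + Q 0 * Q 2) / 2"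
    and Qk: "\<And>k. 2 \<le> k \<Longrightarrow> Q k \<le> (Q (k + 1) + Q (k - 1)) / 2"
  shows "Q 0 = 0"
proof -
  have "Q 2 \<le> Q 1"
  proof (rule ccontr)
    assume "\<not> Q 2 \<le> Q 1"
    define d where "d = Q 2 - Q 1"
    have d: "0 < d" using \<open>\<not> Q 2 \<le> Q 1\<close> by (simp add: d_def)
    have inc: "d \<le> Q (k + 2) - Q (k + 1)" for k
    proof (induction k)
      case (Suc k)
      then show ?case using Qk[of "k + 2"] by (simp add: numeral_3_eq_3 numeral_2_eq_2)
    qed (simp add: d_def numeral_2_eq_2)
    have "k * d \<le> Q (k + 1) - Q 1" for k :: nat
    proof (induction k)
      case (Suc k)
      then show ?case using inc[of k] by (simp add: algebra_simps numeral_2_eq_2)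
    qed simp
    then have "k * d \<le> 1" for k :: nat using Q(1)[of 1] Q(2)[of "k + 1"] by (smt (verit))
    moreover obtain k :: nat where "1 < k * d" using reals_Archimedean3[OF d] by blast
    ultimately show False by (meson not_le)
  qed
  have "Q 1 \<le> (Q 2 + Q 0 * Q 2) / 2" by (rule Q1)
  also have "\<dots> \<le> (Q 1 + (Q 1 * Q 1) * Q 1) / 2"
    using \<open>Q 2 \<le> Q 1\<close> Q Q0 by (intro divide_right_mono add_mono mult_mono) auto
  finally have "Q 1 * (1 - Q 1 * Q 1) \<le> 0" by (simp add: algebra_simps)
  moreover have "Q 1 * Q 1 < 1 * 1" using lt Q(1)[of 1] by (intro mult_strict_mono') auto
  ultimately have "Q 1 = 0" using Q(1)[of 1] by (simp add: mult_le_0_iff)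
  then show ?thesis using Q0 Q(1)[of 0] by simp
qed

text \<open>
  The zero-one law applied to the supremum of the extinction probabilities over the states of a
  given slope. The supremum spares a proof that states of equal slope behave alike; it satisfies
  inequalities instead of the recursion, which is enough for convexity.
\<close>

lemma extinction_zero:
  assumes r: "0 < r" "r < 1" "1 < r ^ 4 + r\<^sup>2"
  shows "extinction r (0, 0) = 0"
proof -
  define Q where "Q k = (SUP s\<in>{s. alive s \<and> slope s = k}. extinction r s)" for k
  have ne: "{s. alive s \<and> slope s = k} \<noteq> {}" for k
  proof -
    have "(0, int k) \<in> {s. alive s \<and> slope s = k}" by (simp add: slope_def)
    then show ?thesis by blast
  qed
  have bdd: "bdd_above (extinction r ` A)" for A
    using extinction_bounds[OF r(1,2)] by (intro bdd_aboveI[of _ 1]) auto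
  have up: "extinction r s \<le> Q (slope s)" if "alive s" for s
    unfolding Q_def using that by (intro cSUP_upper bdd) auto
  have least: "Q k \<le> u" if "\<And>s. alive s \<Longrightarrow> slope s = k \<Longrightarrow> extinction r s \<le> u" for k u
    unfolding Q_def using that by (intro cSUP_least ne) auto
  have Q0: "0 \<le> Q k" for k
  proof -
    obtain s where "alive s" "slope s = k" using ne[of k] by blast
    then show ?thesis using up[of s] extinction_bounds(1)[OF r(1,2), of s] by simp
  qed
  have Q1: "Q k \<le> 1" for k by (rule least) (rule extinction_bounds[OF r(1,2)])
  define E where "E = case_option 1 Q"
  have E: "extinction r s \<le> E (kind s)" for s
    using up extinction_bounds[OF r(1,2)] by (auto simp: E_def kind_def)
  have step: "extinction r s \<le> (if slope s = 0 then Q 1 * Q 1 else if slope s = 1 then (Q 2 + Q 0 * Q 2) / 2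
      else (Q (slope s + 1) + Q (slope s - 1)) / 2)" if s: "alive s" for s
  proof -
    have "extinction r s \<le> (\<Sum>c\<in>UNIV. E (kind (child False c s)) * E (kind (child True c s))) / 2"
      unfolding extinction_split[OF r(1,2) s] using E extinction_bounds[OF r(1,2)] Q0
      by (intro divide_right_mono sum_mono mult_mono) (auto simp: E_def split: option.split)
    then show ?thesis
      using offspring_sum[of "\<lambda>a b. E a * E b", OF _ s] by (simp add: E_def mult.commute split: if_splits)
  qed
  obtain a where a: "0 < a" "\<And>n s. alive s \<Longrightarrow> slope s = 1 \<Longrightarrow> a \<le> mean_percolation r n s"
    using mean_percolation_lower[OF r] by blast
  have "Q 0 = 0"
  proof (rule bounded_subharmonic_zero[of Q])
    have "Q 1 \<le> 1 - a" using a(2) by (intro least extinction_le[OF r(1,2)]) auto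
    then show "Q 1 < 1" using a(1) by simp
    show "Q 0 \<le> Q 1 * Q 1" by (rule least) (drule step, simp)
    show "Q 1 \<le> (Q 2 + Q 0 * Q 2) / 2" by (rule least) (drule step, simp)
    show "Q k \<le> (Q (k + 1) + Q (k - 1)) / 2" if "2 \<le> k" for k
      by (rule least, drule step) (use that in simp)
  qed (use Q0 Q1 in auto)
  then show ?thesis
    using up[of "(0, 0)"] extinction_bounds(1)[OF r(1,2), of "(0, 0)"] by (simp add: slope_def)
qed

lemma percolation_survives:
  assumes r: "0 < r" "r < 1" "1 < r ^ 4 + r\<^sup>2"
  shows "AE t in fair_tree. 0 < percolation_limit r t (0, 0)"
proof -
  have "AE t in fair_tree. of_bool (percolation_limit r t (0, 0) = 0) = (0::real)"
    using extinction_zero[OF r] bounded_integrable[OF measurable_extinction[OF r(1,2)], of _ 1]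
    by (subst integral_nonneg_eq_0_iff_AE[symmetric]) (auto simp: extinction_def)
  then show ?thesis
    by (rule AE_mp, intro AE_I2 impI) (use percolation_limit_bounds[OF r(1,2)] in \<open>force simp: order.strict_iff_order\<close>)
qed

section \<open>Hausdorff measure of the zero set\<close>

lemma hausdorff_premeasure_le:
  assumes "finite S" "A \<subseteq> (\<Union>x\<in>S. V x)" "\<And>x. x \<in> S \<Longrightarrow> bounded (V x)" "\<And>x. x \<in> S \<Longrightarrow> diameter (V x) \<le> \<delta>"
    "0 \<le> \<delta>"
  shows "hausdorff_premeasure s \<delta> A \<le> (\<Sum>x\<in>S. ennreal (diam_pow s (V x)))"
proof -
  obtain h where h: "bij_betw h {..<card S} S"
    using assms(1) bij_betw_from_nat_into_finite by blast
  define U where "U i = (if i < card S then V (h i) else {})" for i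
  have hS: "h i \<in> S" if "i < card S" for i using h that by (auto simp: bij_betw_def)
  have "A \<subseteq> (\<Union>i. U i)"
  proof
    fix a assume "a \<in> A"
    then obtain x where "x \<in> S" "a \<in> V x" using assms(2) by auto
    moreover from \<open>x \<in> S\<close> have "x \<in> h ` {..<card S}" using h by (simp add: bij_betw_def)
    then obtain i where "i < card S" "h i = x" by auto
    ultimately show "a \<in> (\<Union>i. U i)" by (auto simp: U_def)
  qed
  then have "hausdorff_premeasure s \<delta> A \<le> (\<Sum>i. ennreal (diam_pow s (U i)))"
    unfolding hausdorff_premeasure_def
    by (intro INF_lower) (use assms hS in \<open>auto simp: U_def diameter_empty\<close>)
  also have "\<dots> = (\<Sum>i<card S. ennreal (diam_pow s (U i)))"
    by (rule suminf_finite) (auto simp: U_def diam_pow_def)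
  also have "\<dots> = (\<Sum>i<card S. ennreal (diam_pow s (V (h i))))"
    by (simp add: U_def)
  also have "\<dots> = (\<Sum>x\<in>S. ennreal (diam_pow s (V x)))"
    by (rule sum.reindex_bij_betw[OF h])
  finally show ?thesis .
qed

lemma diameter_cell: "diameter (cell l) = 1 / 2 ^ length l"
proof -
  have "real (address l) / 2 ^ length l \<le> (real (address l) + 1) / 2 ^ length l"
    by (intro divide_right_mono) auto
  then show ?thesis
    unfolding cell_def diameter_closed_interval
    by (auto simp: not_less[symmetric] add.commute diff_divide_distrib[symmetric])
qed

lemma bounded_cell: "bounded (cell l)"
  by (simp add: cell_def)

lemma powr_minus_power: "(2 powr - s) ^ n = (1 / 2 ^ n) powr s" for s :: real
  by (simp add: powr_realpow[symmetric] powr_powr powr_minus_divide powr_divide powr_power mult.commute)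

text \<open>
  The live intervals of a given level form a cover of the zero set.
\<close>

lemma hausdorff_measure_eq_0_if_decay:
  assumes e: "signs e" and s: "0 < s"
    and lim: "(\<lambda>n. card (live_set n (coins e) (0, 0)) * (2 powr - s) ^ n) \<longlonglongrightarrow> 0"
  shows "hausdorff_measure s (level_set (signed_takagi e) 0) = 0"
proof -
  let ?L = "level_set (signed_takagi e) 0"
  let ?u = "\<lambda>n. card (live_set n (coins e) (0, 0)) * (2 powr - s) ^ n"
  have "hausdorff_premeasure s \<delta> ?L \<le> 0" if \<delta>: "0 < \<delta>" for \<delta>
  proof (rule tendsto_lowerbound)
    show "(\<lambda>n. ennreal (?u n)) \<longlonglongrightarrow> 0"
      using tendsto_ennrealI[OF lim] by simp
    have "(\<lambda>n. 1 / 2 ^ n :: real) \<longlonglongrightarrow> 0" by real_asymp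
    then have "\<forall>\<^sub>F n in sequentially. 1 / 2 ^ n < \<delta>" using \<delta> by (rule order_tendstoD)
    then show "\<forall>\<^sub>F n in sequentially. hausdorff_premeasure s \<delta> ?L \<le> ennreal (?u n)"
    proof (rule eventually_mono)
      fix n :: nat assume n: "1 / 2 ^ n < \<delta>"
      have "hausdorff_premeasure s \<delta> ?L \<le> (\<Sum>l\<in>live_set n (coins e) (0, 0). ennreal (diam_pow s (cell l)))"
        by (rule hausdorff_premeasure_le[OF finite_live_set])
           (use n \<delta> in \<open>auto simp: level_set_eq_live_cells[OF e] diameter_cell live_set_def bounded_cell\<close>)
      also have "\<dots> = (\<Sum>l\<in>live_set n (coins e) (0, 0). ennreal ((2 powr - s) ^ n))"
      proof (rule sum.cong[OF refl])
        fix l assume "l \<in> live_set n (coins e) (0, 0)"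
        moreover have "cell l \<noteq> {}" using diameter_cell[of l] by auto
        ultimately show "ennreal (diam_pow s (cell l)) = ennreal ((2 powr - s) ^ n)"
          using s by (simp add: diam_pow_def diameter_cell live_set_def powr_minus_power)
      qed
      also have "\<dots> = ennreal (?u n)"
        by (simp add: ennreal_mult ennreal_of_nat_eq_real_of_nat)
      finally show "hausdorff_premeasure s \<delta> ?L \<le> ennreal (?u n)" .
    qed
  qed simp
  then show ?thesis unfolding hausdorff_measure_def
    by (intro antisym SUP_least) auto
qed

text \<open>
  A union bound: a connection from the root to level \<open>n\<close> runs through some node of the cut \<open>C\<close>,
  and a node of depth \<open>k\<close> is connected to the root with probability \<open>r ^ k\<close>. With
  \<open>r = 2 powr - s\<close> the right-hand side is the sum of the \<open>s\<close>-th powers of the interval lengths.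
\<close>

lemma percolation_le_cut:
  assumes r: "0 < r" "r < 1" and "finite C"
    and "\<And>l. l \<in> live_set n t s \<Longrightarrow> \<exists>m\<le>n. take m l \<in> C"
  shows "percolation r n t s \<le> (\<Sum>c\<in>C. r ^ length c)"
  using assms(3,4)
proof (induction n arbitrary: t s C)
  case 0
  have nonneg: "0 \<le> (\<Sum>c\<in>C. r ^ length c)" using r by (intro sum_nonneg) auto
  show ?case
  proof (cases "alive s")
    case True
    then have "[] \<in> C" using 0(2)[of "[]"] by (simp add: live_set_def)
    then have "r ^ length ([] :: bool list) \<le> (\<Sum>c\<in>C. r ^ length c)"
      using r 0(1) by (intro member_le_sum) auto
    then show ?thesis by simp
  qed (use nonneg in simp)
next
  case (Suc n)
  have nonneg: "0 \<le> (\<Sum>c\<in>C. r ^ length c)" using r by (intro sum_nonneg) auto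
  consider "\<not> alive s" | "[] \<in> C" | "alive s" "[] \<notin> C" by blast
  then show ?case
  proof cases
    case 1
    then show ?thesis using nonneg by simp
  next
    case 2
    then have "r ^ length ([] :: bool list) \<le> (\<Sum>c\<in>C. r ^ length c)"
      using r Suc(2) by (intro member_le_sum) auto
    then show ?thesis using percolation_bounds(2)[OF r, of "Suc n" t s] by simp
  next
    case 3
    define D where "D b = {c. b # c \<in> C}" for b
    have D: "finite (D b)" for b
      using finite_vimageI[OF Suc(2), of "(#) b"] by (simp add: D_def vimage_def)
    let ?p = "\<lambda>b. percolation r n (subtree b t) (child b (t []) s)"
    have "?p b \<le> (\<Sum>c\<in>D b. r ^ length c)" for b
    proof (rule Suc.IH[OF D])
      fix l assume "l \<in> live_set n (subtree b t) (child b (t []) s)"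
      then have "b # l \<in> live_set (Suc n) t s" using 3 by (simp add: live_set_def)
      then obtain m where "m \<le> Suc n" "take m (b # l) \<in> C" using Suc(3) by blast
      then show "\<exists>m\<le>n. take m l \<in> D b" using 3(2) by (cases m) (auto simp: D_def)
    qed
    then have "r * ?p b \<le> r * (\<Sum>c\<in>D b. r ^ length c)" for b
      using r by (intro mult_left_mono) auto
    then have p: "r * ?p b \<le> (\<Sum>c\<in>(#) b ` D b. r ^ length c)" for b
      by (simp add: sum.reindex sum_distrib_left)
    have "0 \<le> (r * ?p False) * (r * ?p True)"
      using percolation_bounds(1)[OF r] r by auto
    then have "percolation r (Suc n) t s \<le> r * ?p False + r * ?p True"
      using 3 by (simp add: algebra_simps)
    also have "\<dots> \<le> (\<Sum>c\<in>(#) False ` D False. r ^ length c) + (\<Sum>c\<in>(#) True ` D True. r ^ length c)"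
      by (intro add_mono p)
    also have "\<dots> = (\<Sum>c\<in>(#) False ` D False \<union> (#) True ` D True. r ^ length c)"
      using D by (intro sum.union_disjoint[symmetric]) auto
    also have "\<dots> \<le> (\<Sum>c\<in>C. r ^ length c)"
      using r Suc(2) by (intro sum_mono2) (auto simp: D_def)
    finally show ?thesis .
  qed
qed

text \<open>
  The dyadic intervals of level \<open>m\<close> that come close to a set of diameter at most \<open>2 ^ -m\<close>: their
  left endpoints, in units of \<open>2 ^ -m\<close>, are within 3 of a fixed integer.
\<close>

lemma card_cells_near:
  assumes U: "bounded U" "diameter U \<le> 1 / 2 ^ m"
  shows "finite {c. length c = m \<and> (\<exists>u\<in>U. \<exists>x\<in>cell c. \<bar>x - u\<bar> < 1 / 2 ^ m)} \<and>
    card {c. length c = m \<and> (\<exists>u\<in>U. \<exists>x\<in>cell c. \<bar>x - u\<bar> < 1 / 2 ^ m)} \<le> 7"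
    (is "finite ?C \<and> card ?C \<le> 7")
proof (cases "U = {}")
  case False
  then obtain u0 where u0: "u0 \<in> U" by blast
  define k where "k = \<lfloor>2 ^ m * u0\<rfloor>"
  have fin: "finite ?C"
    using finite_lists_length_eq[of "UNIV :: bool set" m] by (rule rev_finite_subset) auto
  have "int (address c) \<in> {k - 3..k + 3}" if c: "c \<in> ?C" for c
  proof -
    obtain u x where ux: "u \<in> U" "x \<in> cell c" "\<bar>x - u\<bar> < 1 / 2 ^ m" and len: "length c = m"
      using c by auto
    have "\<bar>u - u0\<bar> \<le> 1 / 2 ^ m"
      using diameter_bounded_bound[OF U(1) ux(1) u0] U(2) by (simp add: dist_real_def)
    then have "2 ^ m * \<bar>u - u0\<bar> \<le> 1" by (simp add: field_simps)
    moreover have "2 ^ m * \<bar>x - u\<bar> < 1" using ux by (simp add: field_simps)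
    ultimately have 1: "\<bar>2 ^ m * u - 2 ^ m * u0\<bar> \<le> 1" "\<bar>2 ^ m * x - 2 ^ m * u\<bar> < 1"
      by (simp_all add: abs_mult right_diff_distrib[symmetric])
    have "real (address c) \<le> 2 ^ m * x" "2 ^ m * x \<le> real (address c) + 1"
      using ux(2) len by (simp_all add: cell_def field_simps)
    moreover have "real_of_int k \<le> 2 ^ m * u0" "2 ^ m * u0 < real_of_int k + 1"
      unfolding k_def by linarith+
    ultimately have "real_of_int (int (address c)) < real_of_int (k + 4)"
      "real_of_int (k - 4) < real_of_int (int (address c))"
      using 1 by (simp_all; linarith)+
    then have "int (address c) < k + 4" "k - 4 < int (address c)" by (simp_all only: of_int_less_iff)
    then show ?thesis by simp
  qed
  then have "(\<lambda>c. int (address c)) ` ?C \<subseteq> {k - 3..k + 3}" by blast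
  moreover have "inj_on (\<lambda>c. int (address c)) ?C"
    by (auto simp: inj_on_def intro: address_inj)
  ultimately have "card ?C \<le> card {k - 3..k + 3}" by (intro card_inj_on_le) auto
  then show ?thesis using fin by simp
qed simp

text \<open>
  The dyadic scale just above \<open>d\<close>. The error term \<open>\<eta>\<close> covers the case \<open>d = 0\<close>, where there is no
  such scale.
\<close>

lemma dyadic_scale:
  fixes d \<eta> :: real
  assumes "0 \<le> d" "d \<le> 1 / 2" "0 < s" "0 < \<eta>"
  obtains m :: nat where "d \<le> 1 / 2 ^ m" "(2 powr - s) ^ m \<le> 2 powr s * d powr s + \<eta>"
proof (cases "d = 0")
  case True
  have "2 powr - s < 1" using assms(3) by (simp add: powr_less_one)
  then obtain m where "(2 powr - s) ^ m < \<eta>" using real_arch_pow_inv[OF assms(4)] by blast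
  then show ?thesis using that[of m] True by simp
next
  case False
  then have d: "0 < d" using assms by simp
  define P where "P m \<longleftrightarrow> 1 / 2 ^ m < d" for m :: nat
  obtain m0 where "(1 / 2) ^ m0 < d" using real_arch_pow_inv[OF d, of "1/2"] by auto
  then have "P m0" by (simp add: P_def power_divide)
  then have L: "P (LEAST m. P m)" by (rule LeastI)
  have "\<not> P 0" using assms by (simp add: P_def)
  then obtain m where m: "(LEAST m. P m) = Suc m" using L by (cases "LEAST m. P m") auto
  then have "\<not> P m" using not_less_Least[of m P] by simp
  then have "d \<le> 1 / 2 ^ m" by (simp add: P_def)
  moreover have "1 / 2 ^ m \<le> 2 * d" using L unfolding m by (simp add: P_def)
  then have "(1 / 2 ^ m) powr s \<le> (2 * d) powr s" using assms by (intro powr_mono2) auto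
  then have "(2 powr - s) ^ m \<le> 2 powr s * d powr s + \<eta>"
    using assms d by (simp add: powr_minus_power powr_mult)
  ultimately show ?thesis by (rule that)
qed

lemma cell_subset_take: "cell l \<subseteq> cell (take m l)"
proof (induction l arbitrary: m)
  case (Cons b l)
  show ?case
  proof (cases m)
    case 0
    then show ?thesis using cell_subset by (simp add: cell_Nil)
  next
    case (Suc k)
    show ?thesis
    proof
      fix x assume "x \<in> cell (b # l)"
      moreover have x: "x = (of_bool b + (2 * x - of_bool b)) / 2" by simp
      ultimately have "2 * x - of_bool b \<in> cell l" using mem_cell_Cons[of b "2 * x - of_bool b" l] by simp
      then have "2 * x - of_bool b \<in> cell (take k l)" using Cons by blast
      then show "x \<in> cell (take m (b # l))"
        using mem_cell_Cons[of b "2 * x - of_bool b" "take k l"] Suc x by simp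
    qed
  qed
qed simp

text \<open>
  Mass distribution with \<open>percolation\<close> in the role of the mass. A cover of the zero set is
  thickened to an open one, and compactness leaves finitely many of its sets. Each live interval of
  a high level contains a zero, so one of these sets comes close to it; its ancestor at the scale of
  that set belongs to a cut with at most 7 nodes per covering set. The union bound over the cut
  bounds the percolation probability by a multiple of the sum over the cover.
\<close>

lemma premeasure_pos_if_percolates:
  assumes e: "signs e" and s: "0 < s"
    and a: "0 < a" "\<And>n. a \<le> percolation (2 powr - s) n (coins e) (0, 0)"
  shows "0 < hausdorff_premeasure s (1 / 2) (level_set (signed_takagi e) 0)"
proof -
  let ?L = "level_set (signed_takagi e) 0"
  define r where "r = 2 powr - s"
  have r: "0 < r" "r < 1" using s by (auto simp: r_def powr_less_one)
  have "ennreal (a / 14 / 2 powr s) \<le> (\<Sum>i. ennreal (diam_pow s (U i)))"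
    if U: "?L \<subseteq> (\<Union>i. U i)" "\<And>i. bounded (U i)" "\<And>i. diameter (U i) \<le> 1 / 2" for U :: "nat \<Rightarrow> real set"
  proof -
    \<comment> \<open>The errors for all covering sets add up to at most a / 14, thus to a / 2 after counting 7 nodes each.\<close>
    have "\<exists>m. diameter (U i) \<le> 1 / 2 ^ m \<and>
      r ^ m \<le> 2 powr s * diameter (U i) powr s + a / 14 * (1 / 2) ^ Suc i" for i
      unfolding r_def
      by (rule dyadic_scale[of "diameter (U i)" s "a / 14 * (1 / 2) ^ Suc i"])
         (use U s a diameter_ge_0[OF U(2)] in auto)
    then obtain m where m: "\<And>i. diameter (U i) \<le> 1 / 2 ^ m i"
      "\<And>i. r ^ m i \<le> 2 powr s * diameter (U i) powr s + a / 14 * (1 / 2) ^ Suc i" by metis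
    define V where "V i = (\<Union>u\<in>U i. ball u (1 / 2 ^ m i))" for i
    have "?L \<subseteq> (\<Union>i. V i)"
    proof
      fix x assume "x \<in> ?L"
      then obtain i where "x \<in> U i" using U by blast
      then show "x \<in> (\<Union>i. V i)" by (force simp: V_def)
    qed
    moreover have "open (V i)" for i unfolding V_def by blast
    ultimately obtain I where I: "finite I" "?L \<subseteq> (\<Union>i\<in>I. V i)"
      using compactE_image[OF compact_level_set[OF e], of UNIV V] by auto
    define C where "C i = (if U i = {} then {} else
      {c. length c = m i \<and> (\<exists>u\<in>U i. \<exists>x\<in>cell c. \<bar>x - u\<bar> < 1 / 2 ^ m i)})" for i
    have C: "finite (C i)" "card (C i) \<le> 7" for i
      using card_cells_near[OF U(2) m(1)] by (auto simp: C_def)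
    define n where "n = Max (insert 0 (m ` I))"
    have n: "m i \<le> n" if "i \<in> I" for i unfolding n_def using that I by (intro Max_ge) auto
    have "percolation r n (coins e) (0, 0) \<le> (\<Sum>c\<in>(\<Union>i\<in>I. C i). r ^ length c)"
    proof (rule percolation_le_cut[OF r])
      show "finite (\<Union>i\<in>I. C i)" using I C by blast
      fix l assume l: "l \<in> live_set n (coins e) (0, 0)"
      then obtain z where z: "z \<in> cell l" "height e (0, 0) z = 0"
        using live_cell_has_zero[OF e, of l "(0, 0)"] by (auto simp: live_set_def)
      then have "z \<in> ?L" using cell_subset[of l] by (auto simp: level_set_def height.simps)
      then obtain i u where iu: "i \<in> I" "u \<in> U i" "\<bar>z - u\<bar> < 1 / 2 ^ m i"
        using I by (auto simp: V_def dist_real_def abs_minus_commute)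
      have "length (take (m i) l) = m i" using l n[OF iu(1)] by (simp add: live_set_def)
      then have "take (m i) l \<in> C i"
        using iu z cell_subset_take[of l "m i"] by (auto simp: C_def)
      then show "\<exists>k\<le>n. take k l \<in> (\<Union>i\<in>I. C i)" using iu n by blast
    qed
    also have "\<dots> \<le> (\<Sum>i\<in>I. \<Sum>c\<in>C i. r ^ length c)"
    proof -
      have "(\<Sum>c\<in>(\<Union>i\<in>I. C i). r ^ length c) \<le> (\<Sum>p\<in>Sigma I C. r ^ length (snd p))"
        by (rule sum_le_included[where i = snd]) (use I C r in force)+
      then show ?thesis using I C by (simp add: sum.Sigma case_prod_beta')
    qed
    also have "\<dots> \<le> (\<Sum>i\<in>I. 7 * (2 powr s * diam_pow s (U i) + a / 14 * (1 / 2) ^ Suc i))"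
    proof (rule sum_mono)
      fix i
      show "(\<Sum>c\<in>C i. r ^ length c) \<le> 7 * (2 powr s * diam_pow s (U i) + a / 14 * (1 / 2) ^ Suc i)"
      proof (cases "U i = {}")
        case False
        have "(\<Sum>c\<in>C i. r ^ length c) = card (C i) * r ^ m i" by (simp add: C_def)
        also have "\<dots> \<le> 7 * r ^ m i" using C(2)[of i] r by (intro mult_right_mono) auto
        also have "\<dots> \<le> 7 * (2 powr s * diameter (U i) powr s + a / 14 * (1 / 2) ^ Suc i)"
          using m(2) by (intro mult_left_mono) auto
        finally show ?thesis using False s by (simp add: diam_pow_def)
      qed (use a s in \<open>simp add: C_def diam_pow_def\<close>)
    qed
    also have "\<dots> = 7 * 2 powr s * (\<Sum>i\<in>I. diam_pow s (U i)) + a / 2 * (\<Sum>i\<in>I. (1 / 2) ^ Suc i)"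
      by (simp add: sum.distrib sum_distrib_left algebra_simps)
    also have "(\<Sum>i\<in>I. (1 / 2 :: real) ^ Suc i) \<le> 1"
    proof -
      have s1: "(\<lambda>n. (1 / 2 :: real) ^ Suc n) sums 1"
        using geometric_sums[of "1/2::real"] sums_mult[of "\<lambda>n. (1/2::real)^n" 2 "1/2"] by simp
      show ?thesis using sum_le_suminf[OF sums_summable[OF s1] I(1)] s1 by (simp add: sums_iff)
    qed
    finally have "a \<le> 7 * 2 powr s * (\<Sum>i\<in>I. diam_pow s (U i)) + a / 2 * 1"
      using a(1) a(2)[of n] by (simp add: r_def)
    then have "a / 14 / 2 powr s \<le> (\<Sum>i\<in>I. diam_pow s (U i))"
      by (simp add: field_simps)
    then have "ennreal (a / 14 / 2 powr s) \<le> (\<Sum>i\<in>I. ennreal (diam_pow s (U i)))"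
      by (subst sum_ennreal) (auto simp: diam_pow_def intro!: ennreal_leI)
    also have "\<dots> \<le> (\<Sum>i. ennreal (diam_pow s (U i)))"
      by (rule sum_le_suminf) (use I in auto)
    finally show ?thesis .
  qed
  then have "ennreal (a / 14 / 2 powr s) \<le> hausdorff_premeasure s (1 / 2) ?L"
    unfolding hausdorff_premeasure_def by (intro INF_greatest) auto
  moreover have "0 < ennreal (a / 14 / 2 powr s)" using a by simp
  ultimately show ?thesis by (rule less_le_trans[rotated])
qed

lemma hausdorff_premeasure_antimono:
  assumes "0 \<le> s" "s \<le> s'" "\<delta> \<le> 1"
  shows "hausdorff_premeasure s' \<delta> A \<le> hausdorff_premeasure s \<delta> A"
  unfolding hausdorff_premeasure_def
proof (rule INF_mono, rule bexI)
  fix U assume U: "U \<in> {U :: nat \<Rightarrow> 'a set. A \<subseteq> (\<Union>i. U i) \<and> (\<forall>i. bounded (U i) \<and> diameter (U i) \<le> \<delta>)}"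
  have "diam_pow s' (U i) \<le> diam_pow s (U i)" for i
  proof -
    have d: "0 \<le> diameter (U i)" "diameter (U i) \<le> 1"
      using U assms(3) by (auto intro: diameter_ge_0 order_trans)
    then have "diameter (U i) powr s' \<le> diameter (U i) powr s"
      using assms by (cases "diameter (U i) = 0") (auto intro: powr_mono')
    moreover have "diameter (U i) powr s' \<le> 1" using d assms by (intro powr_le1) auto
    ultimately show ?thesis using assms by (auto simp: diam_pow_def)
  qed
  then show "(\<Sum>i. ennreal (diam_pow s' (U i))) \<le> (\<Sum>i. ennreal (diam_pow s (U i)))"
    by (intro suminf_le summableI ennreal_leI)
qed

text \<open>
  It suffices to test a sequence of exponents on either side; below the dimension, a positive
  premeasure at one fixed scale suffices by monotonicity in the exponent. This includes exponent 0.
\<close>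

lemma hausdorff_dim_eqI:
  assumes d: "0 < d"
    and up: "\<And>k. hausdorff_measure (d + u k) A = 0" "\<And>k. 0 < u k" "u \<longlonglongrightarrow> 0"
    and low: "\<And>k. 0 < hausdorff_premeasure (d - v k) (1 / 2) A" "v \<longlonglongrightarrow> 0"
  shows "hausdorff_dim A = ereal d"
proof (rule antisym)
  have "hausdorff_dim A \<le> ereal (d + u k)" for k
    unfolding hausdorff_dim_def using up(1,2)[of k] d by (intro INF_lower) auto
  moreover have "(\<lambda>k. ereal (d + u k)) \<longlonglongrightarrow> ereal (d + 0)"
    by (intro tendsto_intros up)
  ultimately show "hausdorff_dim A \<le> ereal d"
    using LIMSEQ_le_const[of "\<lambda>k. ereal (d + u k)" "ereal d" "hausdorff_dim A"] by auto
  show "ereal d \<le> hausdorff_dim A"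
    unfolding hausdorff_dim_def
  proof (rule INF_greatest)
    fix s assume "s \<in> {s. 0 \<le> s \<and> hausdorff_measure s A = 0}"
    then have s: "0 \<le> s" "hausdorff_measure s A = 0" by auto
    have "d - v k < s" for k
    proof (rule ccontr)
      assume "\<not> d - v k < s"
      then have "hausdorff_premeasure (d - v k) (1 / 2) A \<le> hausdorff_premeasure s (1 / 2) A"
        using s by (intro hausdorff_premeasure_antimono) auto
      also have "\<dots> \<le> hausdorff_measure s A"
        unfolding hausdorff_measure_def by (intro SUP_upper) auto
      finally show False using low(1)[of k] s by simp
    qed
    moreover have "(\<lambda>k. d - v k) \<longlonglongrightarrow> d - 0" by (intro tendsto_intros low)
    ultimately have "d \<le> s" by (intro LIMSEQ_le_const2[of "\<lambda>k. d - v k"]) (auto intro: less_imp_le)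
    then show "ereal d \<le> ereal s" by simp
  qed
qed

section \<open>The almost sure dimension\<close>

text \<open>
  With \<open>x = 2 powr - s\<close> the critical equation \<open>x ^ 4 + x\<^sup>2 = 1\<close> says that \<open>4 powr - s\<close> is the
  inverse of the golden ratio.
\<close>

lemma golden_dimension:
  fixes s :: real
  defines "d \<equiv> ln ((1 + sqrt 5) / 2) / ln 4"
  shows "d < s \<Longrightarrow> (2 powr - s) ^ 4 + (2 powr - s)\<^sup>2 < 1"
    and "s < d \<Longrightarrow> 1 < (2 powr - s) ^ 4 + (2 powr - s)\<^sup>2"
    and "0 < d"
proof -
  define \<rho> where "\<rho> = 2 / (1 + sqrt 5)"
  define y where "y = (2 powr - s)\<^sup>2"
  have pos: "0 < 1 + sqrt 5" by (intro add_pos_pos) auto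
  have \<rho>: "0 < \<rho>" using pos by (simp add: \<rho>_def)
  have "\<rho>\<^sup>2 + \<rho> = (4 + 2 * (1 + sqrt 5)) / (1 + sqrt 5)\<^sup>2"
    using pos by (simp add: \<rho>_def field_simps power2_eq_square)
  also have "\<dots> = 1" using pos by (simp add: field_simps power2_eq_square)
  finally have eq: "\<rho>\<^sup>2 + \<rho> = 1" .
  have y: "0 < y" by (simp add: y_def)
  have "ln y = - s * ln 4"
  proof -
    have "ln (4::real) = 2 * ln 2" using ln_realpow[of 2 2] by simp
    then show ?thesis by (simp add: y_def ln_realpow ln_powr)
  qed
  moreover have "ln \<rho> = - d * ln 4"
    using pos by (simp add: d_def \<rho>_def ln_div)
  ultimately have less: "y < \<rho> \<longleftrightarrow> d < s" "\<rho> < y \<longleftrightarrow> s < d"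
    using y \<rho> by (simp_all add: ln_less_cancel_iff[symmetric] del: ln_less_cancel_iff)
  have p: "(2 powr - s) ^ 4 + (2 powr - s)\<^sup>2 = y\<^sup>2 + y" by (simp add: y_def)
  show "d < s \<Longrightarrow> (2 powr - s) ^ 4 + (2 powr - s)\<^sup>2 < 1"
    unfolding p less[symmetric] using y power_strict_mono[of y \<rho> 2] eq by simp
  show "s < d \<Longrightarrow> 1 < (2 powr - s) ^ 4 + (2 powr - s)\<^sup>2"
    unfolding p less[symmetric] using \<rho> power_strict_mono[of \<rho> y 2] eq by simp
  have "0 < ln ((1 + sqrt 5) / 2)" by (rule ln_gt_zero) simp
  then show "0 < d" unfolding d_def by (rule divide_pos_pos) simp
qed

theorem theorem1p6:
  fixes M :: "'a measure" and \<omega> :: "nat \<Rightarrow> nat \<Rightarrow> 'a \<Rightarrow> real"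
  assumes "prob_space M"
    and "prob_space.indep_vars M (\<lambda>_. borel) (\<lambda>(n, j). \<omega> n j) (SIGMA n:UNIV. {..<2 ^ n})"
    and "\<And>n j. j < 2 ^ n \<Longrightarrow> measure M {w \<in> space M. \<omega> n j w = 1} = 1 / 2"
    and "\<And>n j. j < 2 ^ n \<Longrightarrow> measure M {w \<in> space M. \<omega> n j w = -1} = 1 / 2"
  shows "AE w in M. hausdorff_dim (level_set (signed_takagi (\<lambda>n j. \<omega> n j w)) 0)
           = ereal (ln ((1 + sqrt 5) / 2) / ln 4)"
proof -
  define d where "d = ln ((1 + sqrt 5) / 2) / ln (4::real)"
  note golden = golden_dimension[folded d_def]
  interpret prob_space M by fact
  have ae: "AE w in M. signs (\<lambda>n j. \<omega> n j w)"
    unfolding signs_def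
  proof (intro AE_all_countable[THEN iffD2] allI)
    fix n j :: nat
    show "AE w in M. j < 2 ^ n \<longrightarrow> \<omega> n j w = 1 \<or> \<omega> n j w = -1"
    proof (cases "j < 2 ^ n")
      case True
      have "(n, j) \<in> (SIGMA n:UNIV. {..<2 ^ n})" using True by simp
      then have m: "\<omega> n j \<in> borel_measurable M"
        using assms(2) unfolding indep_vars_def by fastforce
      let ?E = "\<lambda>c. {w \<in> space M. \<omega> n j w = c}"
      have E: "?E c \<in> events" for c
        using m by measurable
      have "prob (?E 1 \<union> ?E (-1)) = prob (?E 1) + prob (?E (-1))"
        by (rule finite_measure_Union[OF E E]) auto
      then have "prob (?E 1 \<union> ?E (-1)) = 1" using assms(3,4)[OF True] by simp
      then have "AE w in M. w \<in> ?E 1 \<union> ?E (-1)"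
        by (rule AE_prob_1)
      then show ?thesis by (rule AE_mp) (auto intro!: AE_I2)
    qed simp
  qed
  \<comment> \<open>Countably many exponents on both sides of d suffice; the shift by 2 keeps the lower ones positive.\<close>
  define u where "u k = d / real (k + 2)" for k
  have u: "0 < u k" "u k < d" for k
  proof -
    show "0 < u k" unfolding u_def using golden(3) by simp
    have "d * 1 < d * real (k + 2)" using golden(3) by (intro mult_strict_left_mono) auto
    then show "u k < d" unfolding u_def by (simp add: pos_divide_less_eq)
  qed
  have u0: "u \<longlonglongrightarrow> 0" unfolding u_def by real_asymp
  have up_tree: "AE t in fair_tree. \<forall>k. (\<lambda>n. population n t (0, 0) * (2 powr - (d + u k)) ^ n) \<longlonglongrightarrow> 0"
    unfolding AE_all_countable
  proof
    show "AE t in fair_tree. (\<lambda>n. population n t (0, 0) * (2 powr - (d + u k)) ^ n) \<longlonglongrightarrow> 0" for k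
      by (rule population_decay[where y = "2 powr - (d + u k / 2)"]) (use u[of k] golden(1)[of "d + u k / 2"] in auto)
  qed
  have up: "AE w in M. \<forall>k. (\<lambda>n. population n (coins (\<lambda>n j. \<omega> n j w)) (0, 0) * (2 powr - (d + u k)) ^ n) \<longlonglongrightarrow> 0"
    by (rule AE_fair_tree_transfer[OF assms(1,2) _ up_tree]) (rule assms(3))
  have low_tree: "AE t in fair_tree. \<forall>k. 0 < percolation_limit (2 powr - (d - u k)) t (0, 0)"
    unfolding AE_all_countable
  proof
    show "AE t in fair_tree. 0 < percolation_limit (2 powr - (d - u k)) t (0, 0)" for k
      by (rule percolation_survives) (use u[of k] golden(2)[of "d - u k"] in \<open>auto simp: powr_less_one\<close>)
  qed
  have low: "AE w in M. \<forall>k. 0 < percolation_limit (2 powr - (d - u k)) (coins (\<lambda>n j. \<omega> n j w)) (0, 0)"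
    by (rule AE_fair_tree_transfer[OF assms(1,2) _ low_tree]) (rule assms(3))
  show ?thesis
    using ae up low
  proof eventually_elim
    case (elim w)
    let ?e = "\<lambda>n j. \<omega> n j w"
    show ?case unfolding d_def[symmetric]
    proof (rule hausdorff_dim_eqI[where u = u and v = u])
      show "hausdorff_measure (d + u k) (level_set (signed_takagi ?e) 0) = 0" for k
        using elim u[of k] by (intro hausdorff_measure_eq_0_if_decay) (auto simp: population_def)
      show "0 < hausdorff_premeasure (d - u k) (1 / 2) (level_set (signed_takagi ?e) 0)" for k
      proof (rule premeasure_pos_if_percolates)
        show "0 < percolation_limit (2 powr - (d - u k)) (coins ?e) (0, 0)" using elim by blast
        show "percolation_limit (2 powr - (d - u k)) (coins ?e) (0, 0)
            \<le> percolation (2 powr - (d - u k)) n (coins ?e) (0, 0)" for n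
          by (rule percolation_limit_le) (use u[of k] in \<open>auto simp: powr_less_one\<close>)
      qed (use elim u[of k] in auto)
    qed (use golden(3) u u0 in auto)
  qed
qed

end
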